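(* Let $G=(V,E)$ be a directed or undirected graph with $n=|V|$ nodes and positive edge lengths, let $U\subseteq V$ be the set of rankee nodes, and let $S\subseteq U$ be a set of seeds. Assume the neighborhood-estimate lists $L(j)$ are provided for all $j\in V$. Then the values $\hat\pi_{jS}$ for all $j\in V$ can be computed using $O(|S|+|E|\log n)$ operations. Moreover, when the decay function satisfies $\alpha(x)=0$ for $x\ge T$ (so that, for the purpose of computing the approximate influence $\widehat{\mathrm{Inf}}(S)$, only the values $\hat\pi_{jS}$ of nodes $j$ with $\hat\pi_{jS}\le T$ are needed), $|E|$ in this bound is replaced by the number of incoming edges to nodes $j$ that satisfy $\hat\pi_{jS}\le T$.
   Context: For nodes $i,j$, $d_{ij}$ is the shortest-path distance from $i$ to $j$ in $G$. For $y\ge0$, $N_i(y)=\{j\in U: d_{ij}\le y\}$, $n_i(y)=|N_i(y)|$. Bottom-$k$ estimates: fix an integer $k\ge1$ and distinct values $r:U\to(0,1]$. The bottom-$k$ estimate $\hat n_i(y)$ of $n_i(y)$ is $|N_i(y)|$ if $|N_i(y)|<k$, and otherwise $(k-1)/\tau$ where $\tau$ is the $k$-th smallest $r$ value among nodes in $N_i(y)$. The list $L(i)$ is a list of pairs $(x,\hat n_i(x))$, sorted by increasing $x$, such that for every $d\ge 0$, $\hat n_i(d)$ is the second coordinate of the pair with the largest $x\le d$. Thus, from $L(i)$ and a distance $d$, one can look up $\hat n_i(d)$. Estimated ranks: for $j\in V$, $i\in U$, $\hat\pi_{ji}=\hat n_j(d_{ji})$, and $\hat\pi_{jS}=\min_{i\in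 S}\hat\pi_{ji}$. Approximate reverse-rank influence: for ranker weights $\beta:V\to[0,\infty)$ and a non-increasing decay function $\alpha\ge0$, $\widehat{\mathrm{Inf}}(S)=\sum_{j:\beta(j)>0}\beta(j)\,\alpha(\hat\pi_{jS})$.
   Formalization: Each list L(j) is assumed to contain at most n pairs (one per possible distance); with no bound on redundant pairs, looking up an estimate cannot be done in O(log n) operations and the stated bound fails. *)

theory Defs
  imports Complex_Main "HOL-Library.Extended_Real" "Graph_Theory.Graph_Theory"
begin

section \<open>Networks, bottom-k estimates and estimated ranks\<close>

text \<open>
  The node set is \<open>{..<n}\<close>, so that nodes can be used as memory addresses. An undirected graph is
  given by a symmetric set of arcs with symmetric lengths; the flag \<open>dirct\<close> only tells whether the
  two arcs of such a pair are counted as one edge or as two (see \<open>edge_count\<close>).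
\<close>

record network =
  dirct :: bool
  graph :: "nat pair_pre_digraph"
  elen :: "nat \<times> nat \<Rightarrow> real"
  rankees :: "nat set"
  bk :: nat
  rval :: "nat \<Rightarrow> real"

abbreviation nodes :: "network \<Rightarrow> nat set" where
  "nodes X \<equiv> pverts (graph X)"

definition is_network :: "network \<Rightarrow> bool" where
  "is_network X \<longleftrightarrow>
     pair_fin_digraph (graph X) \<and> nodes X = {..<card (nodes X)} \<and>
     (\<forall>e \<in> parcs (graph X). 0 < elen X e) \<and>
     (\<not> dirct X \<longrightarrow>
        (\<forall>u v. (u, v) \<in> parcs (graph X) \<longrightarrow>
           (v, u) \<in> parcs (graph X) \<and> elen X (v, u) = elen X (u, v))) \<and>
     rankees X \<subseteq> nodes X \<and>
     1 \<le> bk X \<and> inj_on (rval X) (rankees X) \<and> rval X ` rankees X \<subseteq> {0<..1}"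

definition edge_count :: "network \<Rightarrow> (nat \<times> nat) set \<Rightarrow> nat" where
  "edge_count X A = (if dirct X then card A else card ((\<lambda>(u, v). {u, v}) ` A))"

definition dst :: "network \<Rightarrow> nat \<Rightarrow> nat \<Rightarrow> ereal" where
  "dst X i j = wf_digraph.\<mu> (with_proj (graph X)) (elen X) i j"

definition nbhd :: "network \<Rightarrow> nat \<Rightarrow> real \<Rightarrow> nat set" where
  "nbhd X i y = {j \<in> rankees X. dst X i j \<le> ereal y}"

definition nhat :: "network \<Rightarrow> nat \<Rightarrow> real \<Rightarrow> real" where
  "nhat X i y =
     (if card (nbhd X i y) < bk X then real (card (nbhd X i y))
      else (real (bk X) - 1) / (sorted_list_of_set (rval X ` nbhd X i y) ! (bk X - 1)))"

text \<open>
  A breakpoint list has at most one pair per node: the neighbourhood of \<open>i\<close> can only change at one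
  of the at most \<open>n\<close> distances from \<open>i\<close> (including \<open>0\<close>, the distance to \<open>i\<close> itself). Without any
  bound on the length, a lookup in logarithmic time would be impossible.
\<close>

definition estimate_list :: "network \<Rightarrow> nat \<Rightarrow> (real \<times> real) list \<Rightarrow> bool" where
  "estimate_list X i xs \<longleftrightarrow>
     sorted_wrt (<) (map fst xs) \<and>
     (\<forall>(x, y) \<in> set xs. 0 \<le> x \<and> y = nhat X i x) \<and>
     (\<forall>d \<ge> 0. \<exists>(x, y) \<in> set xs. x \<le> d \<and> (\<forall>(x', y') \<in> set xs. x' \<le> d \<longrightarrow> x' \<le> x) \<and>
        nhat X i d = y) \<and>
     length xs \<le> card (nodes X)"

text \<open>The rank of an unreachable node is infinite.\<close>

definition est_rank :: "network \<Rightarrow> nat \<Rightarrow> nat \<Rightarrow> ereal" where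
  "est_rank X j i = (if dst X j i = \<infinity> then \<infinity> else ereal (nhat X j (real_of_ereal (dst X j i))))"

text \<open>An infimum over the finite set \<open>S\<close>, hence the minimum, and \<open>\<infinity>\<close> for empty \<open>S\<close>.\<close>

definition est_rank_set :: "network \<Rightarrow> nat set \<Rightarrow> nat \<Rightarrow> ereal" where
  "est_rank_set X S j = (INF i \<in> S. est_rank X j i)"

definition decay_function :: "(ereal \<Rightarrow> real) \<Rightarrow> bool" where
  "decay_function \<alpha> \<longleftrightarrow> antimono_on {0..} \<alpha> \<and> (\<forall>x \<ge> 0. 0 \<le> \<alpha> x)"

definition approx_influence ::
    "network \<Rightarrow> (nat \<Rightarrow> real) \<Rightarrow> (ereal \<Rightarrow> real) \<Rightarrow> nat set \<Rightarrow> real" where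
  "approx_influence X \<beta> \<alpha> S = (\<Sum>j \<in> {j \<in> nodes X. 0 < \<beta> j}. \<beta> j * \<alpha> (est_rank_set X S j))"


section \<open>Machine model\<close>

text \<open>
  Structured programs for a random access machine with addressable memory for natural numbers
  and for real numbers. Memory is organised in named arrays (a program mentions finitely many);
  a scalar variable is cell \<open>0\<close> of an array. On naturals there are constants, addition, truncated
  subtraction, halving and comparison; on reals only addition and comparison. Every memory access,
  constant, operator, comparison, assignment and branch costs one unit.
\<close>

record state =
  nmem :: "string \<Rightarrow> nat \<Rightarrow> nat"
  rmem :: "string \<Rightarrow> nat \<Rightarrow> real"

datatype nexp = NConst nat | NRead string nexp | NAdd nexp nexp | NSub nexp nexp | NHalf nexp

datatype rexp = RRead string nexp | RAdd rexp rexp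

datatype bexp = NLess nexp nexp | RLess rexp rexp | BNot bexp | BAnd bexp bexp

datatype com =
    Skip
  | NWrite string nexp nexp
  | RWrite string nexp rexp
  | Seq com com
  | If bexp com com
  | While bexp com

primrec nval :: "nexp \<Rightarrow> state \<Rightarrow> nat" where
  "nval (NConst c) s = c"
| "nval (NRead a e) s = nmem s a (nval e s)"
| "nval (NAdd e f) s = nval e s + nval f s"
| "nval (NSub e f) s = nval e s - nval f s"
| "nval (NHalf e) s = nval e s div 2"

primrec reval :: "rexp \<Rightarrow> state \<Rightarrow> real" where
  "reval (RRead a e) s = rmem s a (nval e s)"
| "reval (RAdd e f) s = reval e s + reval f s"

primrec bval :: "bexp \<Rightarrow> state \<Rightarrow> bool" where
  "bval (NLess e f) s = (nval e s < nval f s)"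
| "bval (RLess e f) s = (reval e s < reval f s)"
| "bval (BNot b) s = (\<not> bval b s)"
| "bval (BAnd b c) s = (bval b s \<and> bval c s)"

primrec ncost :: "nexp \<Rightarrow> nat" where
  "ncost (NConst c) = 1"
| "ncost (NRead a e) = 1 + ncost e"
| "ncost (NAdd e f) = 1 + ncost e + ncost f"
| "ncost (NSub e f) = 1 + ncost e + ncost f"
| "ncost (NHalf e) = 1 + ncost e"

primrec rcost :: "rexp \<Rightarrow> nat" where
  "rcost (RRead a e) = 1 + ncost e"
| "rcost (RAdd e f) = 1 + rcost e + rcost f"

primrec bcost :: "bexp \<Rightarrow> nat" where
  "bcost (NLess e f) = 1 + ncost e + ncost f"
| "bcost (RLess e f) = 1 + rcost e + rcost f"
| "bcost (BNot b) = 1 + bcost b"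
| "bcost (BAnd b c) = 1 + bcost b + bcost c"

text \<open>\<open>exec c s t s'\<close>: started in \<open>s\<close>, program \<open>c\<close> halts in \<open>s'\<close> after \<open>t\<close> operations.\<close>

inductive exec :: "com \<Rightarrow> state \<Rightarrow> nat \<Rightarrow> state \<Rightarrow> bool" where
  Skip: "exec Skip s 1 s"
| NWrite: "exec (NWrite a e f) s (1 + ncost e + ncost f)
    (s\<lparr>nmem := (nmem s)(a := (nmem s a)(nval e s := nval f s))\<rparr>)"
| RWrite: "exec (RWrite a e f) s (1 + ncost e + rcost f)
    (s\<lparr>rmem := (rmem s)(a := (rmem s a)(nval e s := reval f s))\<rparr>)"
| Seq: "exec c s t s' \<Longrightarrow> exec d s' u s'' \<Longrightarrow> exec (Seq c d) s (t + u) s''"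
| IfTrue: "bval b s \<Longrightarrow> exec c s t s' \<Longrightarrow> exec (If b c d) s (1 + bcost b + t) s'"
| IfFalse: "\<not> bval b s \<Longrightarrow> exec d s t s' \<Longrightarrow> exec (If b c d) s (1 + bcost b + t) s'"
| WhileFalse: "\<not> bval b s \<Longrightarrow> exec (While b c) s (1 + bcost b) s"
| WhileTrue: "bval b s \<Longrightarrow> exec c s t s' \<Longrightarrow> exec (While b c) s' u s'' \<Longrightarrow>
    exec (While b c) s (1 + bcost b + t + u) s''"

inductive_cases exec_SkipE: "exec Skip s t s'"
  and exec_NWriteE: "exec (NWrite a e f) s t s'"
  and exec_RWriteE: "exec (RWrite a e f) s t s'"
  and exec_SeqE: "exec (Seq c d) s t s'"
  and exec_IfE: "exec (If b c d) s t s'"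
  and exec_WhileE: "exec (While b c) s t s'"

lemma exec_deterministic:
  assumes "exec c s t s'" "exec c s u s''"
  shows "t = u \<and> s' = s''"
  using assms
proof (induction arbitrary: u s'' rule: exec.induct)
  case (Seq c s t s1 d v s2)
  then show ?case by (elim exec_SeqE) blast
next
  case (IfTrue b s c t s1 d)
  from IfTrue.prems IfTrue.hyps obtain v where "exec c s v s''" "u = 1 + bcost b + v"
    by (auto elim: exec_IfE)
  with IfTrue.IH show ?case by blast
next
  case (IfFalse b s d t s1 c)
  from IfFalse.prems IfFalse.hyps obtain v where "exec d s v s''" "u = 1 + bcost b + v"
    by (auto elim: exec_IfE)
  with IfFalse.IH show ?case by blast
next
  case (WhileTrue b s c t s1 v s2)
  from WhileTrue.prems WhileTrue.hyps obtain p q r where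
    "exec c s p r" "exec (While b c) r q s''" "u = 1 + bcost b + p + q"
    by (auto elim: exec_WhileE)
  with WhileTrue.IH show ?case by blast
qed (auto elim: exec_SkipE exec_NWriteE exec_RWriteE exec_WhileE)


section \<open>Input and output\<close>

text \<open>
  The memory holds the number of nodes, the seeds in some order without repetition, for every node
  \<open>j\<close> the list of its incoming edges in some order (\<open>indeg\<close> entries of \<open>src\<close> and \<open>elen\<close>, from
  position \<open>inpos\<close> on), and for every node the list \<open>L j\<close> (\<open>Lsize\<close> entries of \<open>Lx\<close> and \<open>Ly\<close>, from
  position \<open>Lpos\<close> on). Apart from the input arrays (including a threshold cell \<open>T\<close>) the memory is
  initially zero; in particular neither the rankee set, nor \<open>bk\<close>, nor the values \<open>rval\<close> are given.
\<close>

definition input_memory ::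
    "network \<Rightarrow> nat set \<Rightarrow> (nat \<Rightarrow> (real \<times> real) list) \<Rightarrow> state \<Rightarrow> bool" where
  "input_memory X S L s \<longleftrightarrow>
     nmem s ''n'' 0 = card (nodes X) \<and>
     (\<exists>xs. distinct xs \<and> set xs = S \<and> nmem s ''nseeds'' 0 = length xs \<and>
        (\<forall>t < length xs. nmem s ''seed'' t = xs ! t)) \<and>
     (\<forall>j \<in> nodes X. \<exists>is. distinct is \<and> set is = {i. (i, j) \<in> parcs (graph X)} \<and>
        nmem s ''indeg'' j = length is \<and>
        (\<forall>t < length is. nmem s ''src'' (nmem s ''inpos'' j + t) = is ! t \<and>
           rmem s ''elen'' (nmem s ''inpos'' j + t) = elen X (is ! t, j))) \<and>
     (\<forall>j \<in> nodes X. nmem s ''Lsize'' j = length (L j) \<and>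
        (\<forall>t < length (L j). rmem s ''Lx'' (nmem s ''Lpos'' j + t) = fst (L j ! t) \<and>
           rmem s ''Ly'' (nmem s ''Lpos'' j + t) = snd (L j ! t))) \<and>
     (\<forall>a i. a \<notin> {''n'', ''nseeds'', ''seed'', ''indeg'', ''inpos'', ''src'', ''Lsize'', ''Lpos''} \<longrightarrow>
        nmem s a i = 0) \<and>
     (\<forall>a i. a \<notin> {''elen'', ''Lx'', ''Ly'', ''T''} \<longrightarrow> rmem s a i = 0)"

text \<open>
  The value output for node \<open>j\<close> is the cell \<open>pi\<close> of \<open>j\<close> if the program has flagged it as found, and
  \<open>\<infinity>\<close> otherwise. Thus infinite values need not be written explicitly, which would take time
  linear in the number of nodes even if there are no edges.
\<close>

definition out_rank :: "state \<Rightarrow> nat \<Rightarrow> ereal" where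
  "out_rank s j = (if nmem s ''found'' j = 0 then \<infinity> else ereal (rmem s ''pi'' j))"

text \<open>
  \<open>O(|S| + m log n)\<close> operations with explicit constant \<open>C\<close>; the maximum with \<open>1\<close> only matters for
  empty \<open>S\<close>, since no program halts after zero operations.
\<close>

definition cost_bound :: "network \<Rightarrow> nat set \<Rightarrow> nat \<Rightarrow> real \<Rightarrow> nat \<Rightarrow> bool" where
  "cost_bound X S m C t \<longleftrightarrow>
     real t \<le> C * (real (max 1 (card S)) + real m * log 2 (real (card (nodes X))))"

end

theory Submission
  imports Defs
begin

text \<open>
  The program is Dijkstra's algorithm on the reversed graph, started from all seeds at once; since
  the estimates are monotone in the distance, the rank of \<open>j\<close> is the estimate looked up at the
  distance from \<open>j\<close> to its nearest seed. If \<open>u\<close> is the second node of a shortest path from \<open>j\<close> to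
  the seeds, then the neighbourhood that determines the rank of \<open>u\<close> is contained in the one of \<open>j\<close>.
  So nodes whose rank exceeds the threshold need not be expanded, and only the arcs into nodes below
  the threshold are ever touched.

  Seeds cost constant time each: they bypass the queue, and their estimate is the first entry of
  their list. Every other node enters the queue through an arc, which pays for its binary search and
  its queue operations. The queue is a tournament tree in an array: cell \<open>n + v\<close> belongs to node
  \<open>v\<close>, cell \<open>p < n\<close> holds the winner among cells \<open>2 p\<close> and \<open>2 p + 1\<close>, and the zero-initialised
  memory is already the empty queue.
\<close>

section \<open>Bottom-k estimates and distances to the seeds\<close>

text \<open>The obstacle is that the program never sees the true ranks: its test evaluates the
  estimate at the distance computed so far, and pruning can leave that distance too large. The
  invariant therefore asks for exact distances only in \<open>near\<close> and is content with upper
  bounds on the distance elsewhere. This suffices because the error is one-sided: a larger distance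
  can only raise the estimate, so passing the test proves membership in \<open>near\<close>, and a
  node of \<open>near\<close> is tested at its exact distance. Both claims of the theorem concern
  one program whose test is a parameter; the search without pruning has threshold
  \<open>\<infinity>\<close>. Termination needs no separate argument, since every loop is run on a
  finite budget.\<close>

lemma sorted_list_of_set_nth_mono:
  fixes A B :: "'a::linorder set"
  assumes "finite B" "A \<subseteq> B" "i < card A"
  shows "sorted_list_of_set B ! i \<le> sorted_list_of_set A ! i"
proof (rule ccontr)
  define as bs where "as = sorted_list_of_set A" and "bs = sorted_list_of_set B"
  have fA: "finite A" using assms finite_subset by blast
  assume "\<not> sorted_list_of_set B ! i \<le> sorted_list_of_set A ! i"
  hence less: "as ! i < bs ! i" by (simp add: as_def bs_def)
  have len: "length as = card A" "length bs = card B" by (simp_all add: as_def bs_def)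
  have sorted: "sorted as" "distinct as" "sorted bs" "distinct bs" by (simp_all add: as_def bs_def)
  have set: "set as = A" "set bs = B" using fA assms(1) by (simp_all add: as_def bs_def)
  \<comment> \<open>Pigeonhole: the first \<open>i + 1\<close> entries of \<open>as\<close> lie in
    \<open>B\<close> and stay below \<open>bs ! i\<close>, so they would have to fit into the first
    \<open>i\<close> places of \<open>bs\<close>.\<close>
  have "(\<lambda>j. as ! j) ` {..i} \<subseteq> (\<lambda>j. bs ! j) ` {..<i}"
  proof
    fix x assume "x \<in> (\<lambda>j. as ! j) ` {..i}"
    then obtain j where j: "j \<le> i" "x = as ! j" by auto
    have "x \<in> set bs" using j set assms len by (metis le_less_trans nth_mem subsetD)
    then obtain l where l: "l < length bs" "bs ! l = x" by (auto simp: in_set_conv_nth)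
    have "x \<le> as ! i" using j sorted len assms by (auto intro: sorted_nth_mono)
    hence "bs ! l < bs ! i" using less l by auto
    hence "l < i" using sorted l by (meson linorder_not_le sorted_nth_mono)
    thus "x \<in> (\<lambda>j. bs ! j) ` {..<i}" using l by auto
  qed
  hence "card ((\<lambda>j. as ! j) ` {..i}) \<le> card ((\<lambda>j. bs ! j) ` {..<i})" by (intro card_mono) auto
  also have "\<dots> \<le> i" using card_image_le[of "{..<i}"] by fastforce
  also have "card ((\<lambda>j. as ! j) ` {..i}) = card {..i}"
    using sorted(2) len assms by (intro card_image inj_onI) (auto simp: nth_eq_iff_index_eq)
  finally show False by simp
qed

text \<open>The estimate as a function of the set alone, so that neighbourhoods of different nodes,
  and not only different radii, can be compared.\<close>

definition bk_estimate :: "network \<Rightarrow> nat set \<Rightarrow> real" where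
  "bk_estimate X A = (if card A < bk X then real (card A)
     else (real (bk X) - 1) / (sorted_list_of_set (rval X ` A) ! (bk X - 1)))"

lemma nhat_eq_bk_estimate: "nhat X i y = bk_estimate X (nbhd X i y)"
  by (simp add: nhat_def bk_estimate_def)

section \<open>Shortest-path distances in a finite digraph\<close>

context fin_digraph
begin

lemma mu_nonneg:
  assumes "\<And>e. e \<in> arcs G \<Longrightarrow> 0 \<le> c e"
  shows "0 \<le> \<mu> c i j"
  unfolding \<mu>_def using pos_cost_pos_awalk_cost[OF _ assms] by (auto intro!: INF_greatest)

lemma mu_self:
  assumes "\<And>e. e \<in> arcs G \<Longrightarrow> 0 \<le> c e" "i \<in> verts G"
  shows "\<mu> c i i = 0"
proof (rule antisym)
  have "awalk i [] i" using assms by (simp add: awalk_Nil_iff)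
  from min_cost_le_walk_cost[OF this, of c] show "\<mu> c i i \<le> 0" by (simp add: zero_ereal_def)
qed (rule mu_nonneg[OF assms(1)])

text \<open>Nonnegative costs reduce the infimum over all walks to simple paths, of which there are
  finitely many.\<close>

lemma mu_attained:
  assumes "\<And>e. e \<in> arcs G \<Longrightarrow> 0 \<le> c e" "\<mu> c i j < \<infinity>"
  obtains p where "awalk i p j" "\<mu> c i j = ereal (awalk_cost c p)"
proof -
  have "i \<rightarrow>\<^sup>* j" using assms(2) by (simp only: \<mu>_reach_conv)
  from min_cost_awalk[where c = c, OF this assms(1)]
  obtain p where "apath i p j" "\<mu> c i j = ereal (awalk_cost c p)" by blast
  thus ?thesis using that by (auto simp: apath_def)
qed

lemma mu_arc_le:
  assumes "\<And>e. e \<in> arcs G \<Longrightarrow> 0 \<le> c e" "arc e (v, u)"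
  shows "\<mu> c v j \<le> ereal (c e) + \<mu> c u j"
proof (cases "\<mu> c u j < \<infinity>")
  case True
  then obtain p where p: "awalk u p j" "\<mu> c u j = ereal (awalk_cost c p)"
    using mu_attained[where c = c, OF assms(1)] by metis
  have "awalk v (e # p) j" using p assms(2) by (auto simp: awalk_Cons_iff arc_def)
  from min_cost_le_walk_cost[OF this, of c] show ?thesis using p by simp
qed simp

text \<open>Take the first arc of an optimal walk, which is nonempty as \<open>v \<noteq> j\<close>.
  The rest of the walk bounds the distance from the head, and \<open>mu_arc_le\<close> is the
  converse.\<close>

lemma mu_arc_tight:
  assumes "\<And>e. e \<in> arcs G \<Longrightarrow> 0 \<le> c e" "\<mu> c v j < \<infinity>" "v \<noteq> j"
  obtains u e where "arc e (v, u)" "\<mu> c v j = ereal (c e) + \<mu> c u j"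
proof -
  obtain p where p: "awalk v p j" "\<mu> c v j = ereal (awalk_cost c p)"
    using assms mu_attained by metis
  then obtain e p' where e: "p = e # p'" using assms(3) by (cases p) (auto simp: awalk_Nil_iff)
  have arc: "arc e (v, head G e)" and p': "awalk (head G e) p' j"
    using p(1) by (auto simp: e awalk_Cons_iff arc_def)
  have "ereal (c e) + \<mu> c (head G e) j \<le> ereal (c e) + ereal (awalk_cost c p')"
    using min_cost_le_walk_cost[OF p', of c] by (intro add_left_mono) simp
  also have "\<dots> = \<mu> c v j" using p(2) by (simp add: e)
  finally have "\<mu> c v j = ereal (c e) + \<mu> c (head G e) j"
    using mu_arc_le[where c = c, OF assms(1) arc, of j] by (simp add: antisym)
  thus ?thesis using that arc by blast
qed

end

section \<open>Monotone estimates and distances in a network\<close>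

locale bk_network =
  fixes X :: network
  assumes network: "is_network X"
begin

lemma pair_fin_graph: "pair_fin_digraph (graph X)"
  using network by (simp add: is_network_def)

lemma nodes_eq: "nodes X = {..<card (nodes X)}"
  and elen_pos: "e \<in> parcs (graph X) \<Longrightarrow> 0 < elen X e"
  and rankees_subset: "rankees X \<subseteq> nodes X"
  and bk_pos: "1 \<le> bk X"
  and inj_rval: "inj_on (rval X) (rankees X)"
  and rval_range: "rval X ` rankees X \<subseteq> {0<..1}"
  using network by (auto simp: is_network_def)

lemma node_iff: "v \<in> nodes X \<longleftrightarrow> v < card (nodes X)"
  using nodes_eq by blast

lemma finite_rankees: "finite (rankees X)"
  using rankees_subset pair_fin_digraph.pair_finite_verts[OF pair_fin_graph] finite_subset by blast

text \<open>By injectivity the image is as large as \<open>A\<close>, so the index is in range and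
  the entry is a genuine value of \<open>rval\<close>.\<close>

lemma threshold_range:
  assumes "A \<subseteq> rankees X" "bk X \<le> card A"
  shows "sorted_list_of_set (rval X ` A) ! (bk X - 1) \<in> {0<..1}"
proof -
  have fin: "finite A" using assms finite_rankees finite_subset by blast
  have "card (rval X ` A) = card A" using inj_rval assms by (meson card_image inj_on_subset)
  hence "sorted_list_of_set (rval X ` A) ! (bk X - 1) \<in> set (sorted_list_of_set (rval X ` A))"
    using assms bk_pos by (intro nth_mem) auto
  hence "sorted_list_of_set (rval X ` A) ! (bk X - 1) \<in> rval X ` A" using fin by simp
  thus ?thesis using assms(1) rval_range by blast
qed

lemma bk_estimate_nonneg: "A \<subseteq> rankees X \<Longrightarrow> 0 \<le> bk_estimate X A"
  using threshold_range[of A] bk_pos by (auto simp: bk_estimate_def)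

text \<open>Among small sets the estimate is the cardinality; among large ones a bigger set has a
  smaller \<open>k\<close>-th value. The passage between the two regimes uses that values are at
  most 1: \<open>card A\<close> is at most \<open>bk X - 1\<close>, and dividing by
  \<open>b \<le> 1\<close> does not decrease this.\<close>

lemma bk_estimate_mono:
  assumes "A \<subseteq> B" "B \<subseteq> rankees X"
  shows "bk_estimate X A \<le> bk_estimate X B"
proof -
  have fin: "finite B" using assms finite_rankees finite_subset by blast
  have card: "card A \<le> card B" using assms fin card_mono by blast
  show ?thesis
  proof (cases "card B < bk X")
    case True
    thus ?thesis using card by (simp add: bk_estimate_def)
  next
    case B: False
    define b where "b = sorted_list_of_set (rval X ` B) ! (bk X - 1)"
    have b: "0 < b" "b \<le> 1" using threshold_range[of B] assms B by (auto simp: b_def)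
    show ?thesis
    proof (cases "card A < bk X")
      case True
      have "(real (bk X) - 1) * b \<le> real (bk X) - 1"
        using b bk_pos by (simp add: mult_left_le)
      hence "real (bk X) - 1 \<le> (real (bk X) - 1) / b" using b by (simp add: field_simps)
      moreover have "real (card A) \<le> real (bk X) - 1" using True by linarith
      ultimately show ?thesis using B True by (simp add: bk_estimate_def b_def)
    next
      case False
      define a where "a = sorted_list_of_set (rval X ` A) ! (bk X - 1)"
      have cardA: "card (rval X ` A) = card A"
        using inj_rval assms by (meson card_image inj_on_subset order_trans)
      have "b \<le> a" unfolding a_def b_def
        using fin assms False bk_pos cardA by (intro sorted_list_of_set_nth_mono) auto
      hence "(real (bk X) - 1) / a \<le> (real (bk X) - 1) / b"
        using b bk_pos by (intro divide_left_mono) auto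
      thus ?thesis using B False by (simp add: bk_estimate_def a_def b_def)
    qed
  qed
qed

lemma nbhd_subset: "nbhd X i y \<subseteq> rankees X"
  by (auto simp: nbhd_def)

lemma nhat_nonneg: "0 \<le> nhat X i y"
  by (simp add: nhat_eq_bk_estimate bk_estimate_nonneg nbhd_subset)

lemma nhat_mono: "x \<le> y \<Longrightarrow> nhat X i x \<le> nhat X i y"
  unfolding nhat_eq_bk_estimate
  by (rule bk_estimate_mono[OF _ nbhd_subset]) (auto simp: nbhd_def intro: order_trans)

lemma fin_graph: "fin_digraph (with_proj (graph X))"
  and wf_graph: "wf_digraph (with_proj (graph X))"
  using pair_fin_graph unfolding pair_fin_digraph_def pair_fin_digraph_axioms_def
  by (auto intro!: fin_digraph.intro fin_digraph_axioms.intro simp: wf_digraph_wp_iff)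

lemma arc_cost_nonneg: "e \<in> arcs (with_proj (graph X)) \<Longrightarrow> 0 \<le> elen X e"
  using elen_pos by (simp add: less_imp_le)

lemma arc_iff: "wf_digraph.arc (with_proj (graph X)) e (v, u) \<longleftrightarrow> e = (v, u) \<and> (v, u) \<in> parcs (graph X)"
  by (cases e) (auto simp: wf_digraph.arc_def[OF wf_graph])

lemma dst_nonneg: "0 \<le> dst X i j"
  unfolding dst_def by (rule fin_digraph.mu_nonneg[where c = "elen X", OF fin_graph arc_cost_nonneg])

lemma dst_self: "i \<in> nodes X \<Longrightarrow> dst X i i = 0"
  unfolding dst_def with_proj_simps(1)[symmetric]
  by (rule fin_digraph.mu_self[where c = "elen X", OF fin_graph arc_cost_nonneg])

lemma dst_arc_le:
  assumes "(v, u) \<in> parcs (graph X)"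
  shows "dst X v j \<le> elen X (v, u) + dst X u j"
  unfolding dst_def
  by (rule fin_digraph.mu_arc_le[where c = "elen X", OF fin_graph arc_cost_nonneg]) (simp_all add: arc_iff assms)

lemma dst_arc_tight:
  assumes "dst X v j < \<infinity>" "v \<noteq> j"
  obtains u where "(v, u) \<in> parcs (graph X)" "dst X v j = elen X (v, u) + dst X u j"
  using fin_digraph.mu_arc_tight[where c = "elen X", OF fin_graph arc_cost_nonneg assms[unfolded dst_def]] that
  unfolding dst_def arc_iff by metis

end

section \<open>Distance to the nearest seed\<close>

definition seed_dist :: "network \<Rightarrow> nat set \<Rightarrow> nat \<Rightarrow> ereal" where
  "seed_dist X S v = (INF i \<in> S. dst X v i)"

locale seeded_network = bk_network +
  fixes S :: "nat set"
  assumes seeds: "S \<subseteq> rankees X"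
begin

abbreviation "D \<equiv> seed_dist X S"

lemma seeds_subset: "S \<subseteq> nodes X"
  using seeds rankees_subset by blast

lemma finite_seeds: "finite S"
  using seeds finite_rankees finite_subset by blast

lemma seed_dist_nonneg: "0 \<le> D v"
  by (simp add: seed_dist_def INF_greatest dst_nonneg)

lemma seed_dist_le: "i \<in> S \<Longrightarrow> D v \<le> dst X v i"
  by (simp add: seed_dist_def INF_lower)

lemma seed_dist_attained:
  assumes "D v < \<infinity>"
  obtains i where "i \<in> S" "D v = dst X v i"
proof -
  have "D v = \<infinity>" if "S = {}" using that by (simp add: seed_dist_def top_ereal_def)
  hence "S \<noteq> {}" using assms by auto
  hence "D v \<in> dst X v ` S" unfolding seed_dist_def
    using finite_seeds by (intro finite_INF_in)
  thus ?thesis using that by auto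
qed

lemma seed_dist_seed: assumes "i \<in> S" shows "D i = 0"
proof (rule antisym)
  have "i \<in> nodes X" using assms seeds_subset by blast
  thus "D i \<le> 0" using seed_dist_le[OF assms, of i] by (simp only: dst_self)
qed (rule seed_dist_nonneg)

lemma seed_dist_arc_le:
  assumes "(v, u) \<in> parcs (graph X)"
  shows "D v \<le> elen X (v, u) + D u"
proof (cases "D u < \<infinity>")
  case True
  then obtain i where "i \<in> S" "D u = dst X u i" by (rule seed_dist_attained)
  thus ?thesis using order_trans[OF seed_dist_le[of i v] dst_arc_le[OF assms, of i]] by simp
qed simp

text \<open>An arc that is tight for a nearest seed of \<open>v\<close> is tight for
  \<open>D\<close>: were another seed closer to \<open>u\<close>, it would also be closer to
  \<open>v\<close>.\<close>

lemma seed_dist_arc_tight: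
  assumes "D v < \<infinity>" "v \<notin> S"
  obtains u where "(v, u) \<in> parcs (graph X)" "D v = elen X (v, u) + D u"
proof -
  obtain i where i: "i \<in> S" "D v = dst X v i" using seed_dist_attained assms by blast
  with assms obtain u where u: "(v, u) \<in> parcs (graph X)" "dst X v i = elen X (v, u) + dst X u i"
    using dst_arc_tight by metis
  have "elen X (v, u) + D u \<le> D v" using i u seed_dist_le[of i u] by (simp add: add_left_mono)
  thus ?thesis using that u seed_dist_arc_le antisym by blast
qed

lemma est_rank_set_eq:
  "est_rank_set X S v = (if D v = \<infinity> then \<infinity> else ereal (nhat X v (real_of_ereal (D v))))"
proof (cases "D v = \<infinity>")
  case True
  have "dst X v i = \<infinity>" if "i \<in> S" for i
    using seed_dist_le[OF that, of v] unfolding True by (simp only: ereal_infty_less_eq)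
  hence "est_rank X v i = \<infinity>" if "i \<in> S" for i using that by (simp add: est_rank_def)
  hence "est_rank_set X S v = (INF i\<in>S. \<infinity>)" unfolding est_rank_set_def by (intro INF_cong) auto
  also have "\<dots> = \<infinity>" by (cases "S = {}") (auto simp: top_ereal_def)
  finally show ?thesis using True by simp
next
  case False
  then obtain i where i: "i \<in> S" "D v = dst X v i" using seed_dist_attained[of v] by auto
  have "est_rank_set X S v = ereal (nhat X v (real_of_ereal (D v)))"
    unfolding est_rank_set_def
  proof (rule antisym)
    show "(INF i\<in>S. est_rank X v i) \<le> ereal (nhat X v (real_of_ereal (D v)))"
      using i False by (intro INF_lower2[OF i(1)]) (simp add: est_rank_def)
    show "ereal (nhat X v (real_of_ereal (D v))) \<le> (INF i\<in>S. est_rank X v i)"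
    proof (rule INF_greatest)
      fix j assume j: "j \<in> S"
      show "ereal (nhat X v (real_of_ereal (D v))) \<le> est_rank X v j"
        using seed_dist_le[OF j, of v] seed_dist_nonneg[of v] False
        by (auto simp: est_rank_def intro!: nhat_mono real_of_ereal_positive_mono)
    qed
  qed
  thus ?thesis using False by simp
qed

text \<open>Along a tight arc the neighbourhoods that determine the ranks are nested, so the search can
  be pruned as soon as a rank exceeds the threshold.\<close>

lemma est_rank_set_tight_mono:
  assumes "D v < \<infinity>" "(v, u) \<in> parcs (graph X)" "D v = elen X (v, u) + D u"
  shows "est_rank_set X S u \<le> est_rank_set X S v"
proof -
  obtain a where a: "D u = ereal a"
    using assms(1,3) seed_dist_nonneg[of u] by (cases "D u") auto
  have "nbhd X u a \<subseteq> nbhd X v (elen X (v, u) + a)"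
  proof
    fix j assume j: "j \<in> nbhd X u a"
    have "dst X v j \<le> elen X (v, u) + dst X u j" by (rule dst_arc_le[OF assms(2)])
    also have "\<dots> \<le> elen X (v, u) + ereal a" using j by (intro add_left_mono) (simp add: nbhd_def)
    finally show "j \<in> nbhd X v (elen X (v, u) + a)" using j by (simp add: nbhd_def)
  qed
  hence "nhat X u a \<le> nhat X v (elen X (v, u) + a)"
    unfolding nhat_eq_bk_estimate by (rule bk_estimate_mono[OF _ nbhd_subset])
  thus ?thesis using assms(3) a by (simp add: est_rank_set_eq)
qed

end

section \<open>Weakest preconditions with credits\<close>

text \<open>The postcondition receives the unspent part of the budget \<open>k\<close>, so that loop invariants can carry
  amortised costs.\<close>

definition wp :: "com \<Rightarrow> (nat \<Rightarrow> state \<Rightarrow> bool) \<Rightarrow> nat \<Rightarrow> state \<Rightarrow> bool" where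
  "wp c Q k s \<longleftrightarrow> (\<exists>t s'. exec c s t s' \<and> t \<le> k \<and> Q (k - t) s')"

lemma wp_Skip: "1 \<le> k \<Longrightarrow> Q (k - 1) s \<Longrightarrow> wp Skip Q k s"
  unfolding wp_def using exec.Skip by blast

lemma wp_NWrite:
  "1 + ncost e + ncost f \<le> k \<Longrightarrow>
   Q (k - (1 + ncost e + ncost f)) (s\<lparr>nmem := (nmem s)(a := (nmem s a)(nval e s := nval f s))\<rparr>) \<Longrightarrow>
   wp (NWrite a e f) Q k s"
  unfolding wp_def using exec.NWrite by blast

lemma wp_RWrite:
  "1 + ncost e + rcost f \<le> k \<Longrightarrow>
   Q (k - (1 + ncost e + rcost f)) (s\<lparr>rmem := (rmem s)(a := (rmem s a)(nval e s := reval f s))\<rparr>) \<Longrightarrow>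
   wp (RWrite a e f) Q k s"
  unfolding wp_def using exec.RWrite by blast

lemma wp_Seq:
  assumes "wp c (wp d Q) k s" shows "wp (Seq c d) Q k s"
proof -
  obtain t s' u s'' where "exec c s t s'" "t \<le> k" "exec d s' u s''" "u \<le> k - t" "Q (k - t - u) s''"
    using assms unfolding wp_def by blast
  thus ?thesis unfolding wp_def
    by (intro exI[of _ "t + u"] exI[of _ s'']) (auto intro: exec.Seq)
qed

lemma wp_If:
  assumes "1 + bcost b \<le> k"
    "bval b s \<Longrightarrow> wp c Q (k - (1 + bcost b)) s"
    "\<not> bval b s \<Longrightarrow> wp d Q (k - (1 + bcost b)) s"
  shows "wp (If b c d) Q k s"
proof (cases "bval b s")
  case True
  then obtain t s' where t: "exec c s t s'" "t \<le> k - (1 + bcost b)" "Q (k - (1 + bcost b) - t) s'"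
    using assms(2) unfolding wp_def by blast
  thus ?thesis unfolding wp_def using exec.IfTrue[OF True t(1), of d] assms(1)
    by (intro exI[of _ "1 + bcost b + t"] exI[of _ s']) auto
next
  case False
  then obtain t s' where t: "exec d s t s'" "t \<le> k - (1 + bcost b)" "Q (k - (1 + bcost b) - t) s'"
    using assms(3) unfolding wp_def by blast
  thus ?thesis unfolding wp_def using exec.IfFalse[OF False t(1), of c] assms(1)
    by (intro exI[of _ "1 + bcost b + t"] exI[of _ s']) auto
qed

text \<open>No variant is required: each round spends at least \<open>1 + bcost b\<close>, so the
  budget itself is the induction measure.\<close>

lemma wp_While:
  assumes "I k s"
    and cost: "\<And>k s. I k s \<Longrightarrow> 1 + bcost b \<le> k"
    and step: "\<And>k s. I k s \<Longrightarrow> bval b s \<Longrightarrow> wp c I (k - (1 + bcost b)) s"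
    and exit: "\<And>k s. I k s \<Longrightarrow> \<not> bval b s \<Longrightarrow> Q (k - (1 + bcost b)) s"
  shows "wp (While b c) Q k s"
  using assms(1)
proof (induction k arbitrary: s rule: less_induct)
  case (less k)
  note k = cost[OF less.prems]
  show ?case
  proof (cases "bval b s")
    case True
    then obtain t s' where t: "exec c s t s'" "t \<le> k - (1 + bcost b)" "I (k - (1 + bcost b) - t) s'"
      using step[OF less.prems] unfolding wp_def by blast
    have "wp (While b c) Q (k - (1 + bcost b) - t) s'" using k t(2) by (intro less.IH t(3)) auto
    then obtain u s'' where u: "exec (While b c) s' u s''" "u \<le> k - (1 + bcost b) - t"
      "Q (k - (1 + bcost b) - t - u) s''" unfolding wp_def by blast
    show ?thesis unfolding wp_def using exec.WhileTrue[OF True t(1) u(1)] k t(2) u(2,3)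
      by (intro exI[of _ "1 + bcost b + t + u"] exI[of _ s'']) auto
  next
    case False
    thus ?thesis unfolding wp_def using exec.WhileFalse[OF False, of c] k exit[OF less.prems] by auto
  qed
qed

abbreviation V :: "string \<Rightarrow> nexp" where
  "V x \<equiv> NRead x (NConst 0)"

abbreviation assign :: "string \<Rightarrow> nexp \<Rightarrow> com" where
  "assign x e \<equiv> NWrite x (NConst 0) e"

section \<open>Tournament tree\<close>

text \<open>In heap numbering the ancestors of a cell are its iterated halves. If \<open>n\<close>
  is not a power of two, the leaves lie at two depths, hence the quantifier over
  \<open>k\<close>.\<close>

definition leaves :: "nat \<Rightarrow> nat \<Rightarrow> nat set" where
  "leaves n p = {v. v < n \<and> (\<exists>k. (n + v) div 2 ^ k = p)}"

text \<open>Winners are stored shifted by one: node 0 is a legal winner, while the value 0 must mean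
  that no leaf below is queued.\<close>

definition best :: "nat \<Rightarrow> (nat \<Rightarrow> nat) \<Rightarrow> (nat \<Rightarrow> real) \<Rightarrow> nat \<Rightarrow> bool" where
  "best n win d p \<longleftrightarrow>
     (if \<forall>v\<in>leaves n p. win (n + v) = 0 then win p = 0
      else \<exists>v\<in>leaves n p. win (n + v) \<noteq> 0 \<and> win p = v + 1 \<and>
             (\<forall>w\<in>leaves n p. win (n + w) \<noteq> 0 \<longrightarrow> d v \<le> d w))"

text \<open>The maximum includes the root even for \<open>n = 0\<close>: then it must hold \<open>0\<close>, the mark of an empty queue.\<close>

definition tournament :: "nat \<Rightarrow> (nat \<Rightarrow> nat) \<Rightarrow> (nat \<Rightarrow> real) \<Rightarrow> bool" where
  "tournament n win d \<longleftrightarrow> (\<forall>p\<in>{1..<max 2 (2 * n)}. best n win d p)"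

text \<open>As \<open>p < n\<close>, the cell \<open>p\<close> is not a leaf cell, so a leaf below
  it reaches it by at least one halving, the last one from a child.\<close>

lemma leaves_inner:
  assumes "p < n"
  shows "leaves n p = leaves n (2 * p) \<union> leaves n (2 * p + 1)"
proof (intro equalityI subsetI)
  fix v assume "v \<in> leaves n p"
  then obtain k where k: "v < n" "(n + v) div 2 ^ k = p" by (auto simp: leaves_def)
  with assms obtain l where l: "k = Suc l" by (cases k) auto
  have "(n + v) div 2 ^ l div 2 = p" using k(2) unfolding l by (simp only: power_Suc2 div_mult2_eq)
  hence "(n + v) div 2 ^ l = 2 * p \<or> (n + v) div 2 ^ l = 2 * p + 1" by linarith
  thus "v \<in> leaves n (2 * p) \<union> leaves n (2 * p + 1)" using k by (auto simp: leaves_def)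
next
  fix v assume "v \<in> leaves n (2 * p) \<union> leaves n (2 * p + 1)"
  then obtain k where k: "v < n" "(n + v) div 2 ^ k = 2 * p \<or> (n + v) div 2 ^ k = 2 * p + 1"
    by (auto simp: leaves_def)
  hence "(n + v) div 2 ^ k div 2 = p" by auto
  hence "(n + v) div 2 ^ Suc k = p" by (simp only: power_Suc2 div_mult2_eq)
  thus "v \<in> leaves n p" using k(1) unfolding leaves_def by blast
qed

text \<open>A single halving already takes any leaf cell, being less than \<open>2 * n\<close>,
  below \<open>n\<close>; no leaf cell is an ancestor of another.\<close>

lemma leaves_leaf:
  assumes "v < n"
  shows "leaves n (n + v) = {v}"
proof -
  have "w = v" if w: "w < n" "(n + w) div 2 ^ k = n + v" for w k
  proof (cases k)
    case (Suc l)
    have "(n + w) div 2 ^ k = (n + w) div 2 div 2 ^ l" by (simp add: Suc div_mult2_eq)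
    also have "\<dots> \<le> (n + w) div 2" by (rule div_le_dividend)
    finally show ?thesis using w by linarith
  qed (use w in simp)
  moreover have "(n + v) div 2 ^ 0 = n + v" by simp
  ultimately show ?thesis using assms unfolding leaves_def by blast
qed

lemma halve_to_one: "1 \<le> m \<Longrightarrow> \<exists>k. m div 2 ^ k = (1::nat)"
proof (induction m rule: less_induct)
  case (less m)
  show ?case
  proof (cases "m = 1")
    case True
    thus ?thesis by (intro exI[of _ 0]) simp
  next
    case False
    hence "1 \<le> m div 2" "m div 2 < m" using less.prems by linarith+
    then obtain k where "m div 2 div 2 ^ k = 1" using less.IH by blast
    thus ?thesis by (intro exI[of _ "Suc k"]) (simp add: div_mult2_eq)
  qed
qed

lemma leaves_root: "leaves n 1 = {..<n}"
  unfolding leaves_def using halve_to_one by auto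

text \<open>\<open>best\<close> inspects the cell \<open>q\<close> and leaf cells only, so rewriting
  an inner cell affects no statement but its own.\<close>

lemma best_update_inner: "p < n \<Longrightarrow> q \<noteq> p \<Longrightarrow> best n (win(p := x)) d q = best n win d q"
  unfolding best_def by auto

lemma best_cong:
  assumes "best n win d q" "win' q = win q"
    and "\<And>w. w \<in> leaves n q \<Longrightarrow> win' (n + w) = win (n + w) \<and> d' w = d w"
  shows "best n win' d' q"
proof (cases "\<forall>v\<in>leaves n q. win (n + v) = 0")
  case True
  thus ?thesis using assms by (auto simp: best_def)
next
  case False
  then obtain v where "v \<in> leaves n q" "win (n + v) \<noteq> 0" "win q = v + 1"
    "\<forall>w\<in>leaves n q. win (n + w) \<noteq> 0 \<longrightarrow> d v \<le> d w"
    using assms(1) unfolding best_def if_not_P[OF False] by blast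
  moreover have "\<not> (\<forall>v\<in>leaves n q. win' (n + v) = 0)" using False assms(3) by auto
  ultimately show ?thesis using assms(2,3) unfolding best_def by auto
qed

lemma best_update_leaf:
  assumes "best n win d q" "v \<notin> leaves n q" "q \<noteq> n + v"
  shows "best n (win(n + v := x)) (d(v := y)) q"
  using assms by (intro best_cong[OF assms(1)]) auto

lemma best_leaf:
  assumes "v < n" "win (n + v) = 0 \<or> win (n + v) = v + 1"
  shows "best n win d (n + v)"
  using assms by (auto simp: best_def leaves_leaf)

text \<open>The condition mirrors the test in \<open>tree_up\<close>: the right child wins if it is
  nonempty and the left one is empty or strictly farther.\<close>

lemma best_combine:
  assumes "1 \<le> p" "p < n" "best n win d (2 * p)" "best n win d (2 * p + 1)"
  shows "best n (win(p :=
    if 0 < win (2 * p + 1) \<and> \<not> (0 < win (2 * p) \<and> \<not> d (win (2 * p + 1) - 1) < d (win (2 * p) - 1))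
    then win (2 * p + 1) else win (2 * p))) d p"
proof -
  let ?A = "{v \<in> leaves n (2 * p). win (n + v) \<noteq> 0}"
  let ?B = "{v \<in> leaves n (2 * p + 1). win (n + v) \<noteq> 0}"
  have A: "(?A = {} \<and> win (2 * p) = 0) \<or> (\<exists>v\<in>?A. win (2 * p) = v + 1 \<and> (\<forall>w\<in>?A. d v \<le> d w))"
    using assms(3) unfolding best_def by (auto split: if_splits)
  have B: "(?B = {} \<and> win (2 * p + 1) = 0) \<or>
      (\<exists>v\<in>?B. win (2 * p + 1) = v + 1 \<and> (\<forall>w\<in>?B. d v \<le> d w))"
    using assms(4) unfolding best_def by (auto split: if_splits)
  have best_iff: "best n (win(p := x)) d p \<longleftrightarrow>
     (?A \<union> ?B = {} \<and> x = 0) \<or> (\<exists>v\<in>?A \<union> ?B. x = v + 1 \<and> (\<forall>w\<in>?A \<union> ?B. d v \<le> d w))" for x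
    using assms(2) unfolding best_def leaves_inner[OF assms(2)] by auto
  show ?thesis
    using A
  proof (elim disjE)
    assume "?A = {} \<and> win (2 * p) = 0"
    thus ?thesis unfolding best_iff using B by auto
  next
    assume "\<exists>v\<in>?A. win (2 * p) = v + 1 \<and> (\<forall>w\<in>?A. d v \<le> d w)"
    then obtain v where v: "v \<in> ?A" "win (2 * p) = v + 1" "\<forall>w\<in>?A. d v \<le> d w" by blast
    from B show ?thesis
    proof
      assume "?B = {} \<and> win (2 * p + 1) = 0"
      thus ?thesis unfolding best_iff using v by auto
    next
      assume "\<exists>v\<in>?B. win (2 * p + 1) = v + 1 \<and> (\<forall>w\<in>?B. d v \<le> d w)"
      then obtain w where w: "w \<in> ?B" "win (2 * p + 1) = w + 1" "\<forall>x\<in>?B. d w \<le> d x" by blast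
      show ?thesis
      proof (cases "d w < d v")
        case True
        hence "\<forall>x\<in>?A \<union> ?B. d w \<le> d x" using v(3) w(3) by fastforce
        thus ?thesis unfolding best_iff using True v(2) w by (intro disjI2 bexI[of _ w]) auto
      next
        case False
        hence "\<forall>x\<in>?A \<union> ?B. d v \<le> d x" using v(3) w(3) by fastforce
        thus ?thesis unfolding best_iff using False v w(2) by (intro disjI2 bexI[of _ v]) auto
      qed
    qed
  qed
qed

text \<open>Only the proper ancestors of \<open>p\<close> may still hold outdated winners.\<close>

definition repaired_below :: "nat \<Rightarrow> (nat \<Rightarrow> nat) \<Rightarrow> (nat \<Rightarrow> real) \<Rightarrow> nat \<Rightarrow> bool" where
  "repaired_below n win d p \<longleftrightarrow> (\<forall>q\<in>{1..<2 * n}. (\<forall>k. q \<noteq> p div 2 ^ Suc k) \<longrightarrow> best n win d q)"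

text \<open>A changed leaf is visible only to itself and its ancestors, and the latter are exempt.
  The key \<open>y\<close> is free, so this serves insertion, improvement and deletion
  alike.\<close>

lemma repaired_below_leaf:
  assumes "tournament n win d" "v < n" "x = 0 \<or> x = v + 1"
  shows "repaired_below n (win(n + v := x)) (d(v := y)) (n + v)"
  unfolding repaired_below_def
proof (intro ballI impI)
  fix q assume q: "q \<in> {1..<2 * n}" "\<forall>k. q \<noteq> (n + v) div 2 ^ Suc k"
  show "best n (win(n + v := x)) (d(v := y)) q"
  proof (cases "q = n + v")
    case True
    thus ?thesis using assms by (auto intro!: best_leaf)
  next
    case False
    have "v \<notin> leaves n q"
    proof
      assume "v \<in> leaves n q"
      then obtain k where "(n + v) div 2 ^ k = q" by (auto simp: leaves_def)
      thus False using q(2) False by (cases k) auto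
    qed
    thus ?thesis using assms(1) q(1) False by (intro best_update_leaf) (auto simp: tournament_def)
  qed
qed

text \<open>Disjunction is expressed through \<open>BNot\<close> and \<open>BAnd\<close>, which
  evaluate both operands. For an empty child the truncated subtraction reads the distance of node 0;
  the other two tests mask that value.\<close>

definition tree_up :: com where
  "tree_up = While (NLess (NConst 1) (V ''p''))
     (Seq (assign ''p'' (NHalf (V ''p'')))
       (let l = NRead ''win'' (NAdd (V ''p'') (V ''p''));
            r = NRead ''win'' (NAdd (NAdd (V ''p'') (V ''p'')) (NConst 1))
        in If (BAnd (NLess (NConst 0) r)
                 (BNot (BAnd (NLess (NConst 0) l)
                   (BNot (RLess (RRead ''dist'' (NSub r (NConst 1))) (RRead ''dist'' (NSub l (NConst 1))))))))
             (NWrite ''win'' (V ''p'') r)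
             (NWrite ''win'' (V ''p'') l)))"

lemma repaired_below_step:
  assumes rep: "repaired_below n win d p" and p: "1 < p" "p < 2 * n"
  defines "h \<equiv> p div 2"
  shows "repaired_below n (win(h :=
    if 0 < win (2 * h + 1) \<and> \<not> (0 < win (2 * h) \<and> \<not> d (win (2 * h + 1) - 1) < d (win (2 * h) - 1))
    then win (2 * h + 1) else win (2 * h))) d h"
proof -
  have h: "1 \<le> h" "h < n" using p by (auto simp: h_def)
  \<comment> \<open>Proper ancestors of \<open>p\<close> are at most \<open>h\<close>, while both
    children of \<open>h\<close> exceed \<open>h\<close>; hence both of them, including the sibling
    of \<open>p\<close>, are already repaired.\<close>
  have above: "p div 2 ^ Suc k \<le> h" for k
    unfolding h_def by (simp add: div_mult2_eq)
  have b: "best n win d q" if "q = 2 * h \<or> q = 2 * h + 1" for q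
  proof -
    have "h < q" "q \<in> {1..<2 * n}" using h that by auto
    moreover have "q \<noteq> p div 2 ^ Suc k" for k using above[of k] \<open>h < q\<close> by linarith
    ultimately show ?thesis using rep unfolding repaired_below_def by blast
  qed
  show ?thesis
    unfolding repaired_below_def
  proof (intro ballI impI)
    fix q assume q: "q \<in> {1..<2 * n}" "\<forall>k. q \<noteq> h div 2 ^ Suc k"
    show "best n (win(h :=
      if 0 < win (2 * h + 1) \<and> \<not> (0 < win (2 * h) \<and> \<not> d (win (2 * h + 1) - 1) < d (win (2 * h) - 1))
      then win (2 * h + 1) else win (2 * h))) d q"
    proof (cases "q = h")
      case True
      thus ?thesis using best_combine[OF h b b] by simp
    next
      case False
      have "q \<noteq> p div 2 ^ Suc k" for k
      proof (cases k)
        case 0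
        thus ?thesis using False by (simp add: h_def)
      next
        case (Suc l)
        have "p div 2 ^ Suc k = h div 2 ^ Suc l" by (simp only: Suc h_def power_Suc div_mult2_eq)
        thus ?thesis using q(2) by simp
      qed
      hence "best n win d q" using rep q(1) unfolding repaired_below_def by blast
      thus ?thesis using best_update_inner[OF h(2) False] by simp
    qed
  qed
qed

lemma wp_tree_up:
  assumes rep: "repaired_below n (nmem s ''win'') (rmem s ''dist'') (nmem s ''p'' 0)"
    and p: "1 \<le> nmem s ''p'' 0" "nmem s ''p'' 0 < 2 * n" "n \<le> 2 ^ K"
    and k: "70 * K + 10 \<le> k"
    and post: "\<And>k' win p. k \<le> k' + (70 * K + 10) \<Longrightarrow> tournament n win (rmem s ''dist'') \<Longrightarrow>
      (\<forall>i\<ge>n. win i = nmem s ''win'' i) \<Longrightarrow>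
      Q k' (s\<lparr>nmem := (nmem s)(''win'' := win, ''p'' := p)\<rparr>)"
  shows "wp tree_up Q k s"
proof -
  \<comment> \<open>\<open>j\<close> bounds the number of levels still to climb, at 70 units each.
    The last two conditions point in opposite directions: enough budget is left, and not too much
    has been spent, so that the caller gets the rest back.\<close>
  define I where "I k' s' \<longleftrightarrow> (\<exists>win p j. s' = s\<lparr>nmem := (nmem s)(''win'' := win, ''p'' := p)\<rparr> \<and>
     repaired_below n win (rmem s ''dist'') (p 0) \<and> 1 \<le> p 0 \<and> p 0 < 2 * n \<and> p 0 < 2 ^ Suc j \<and>
     j \<le> K \<and> (\<forall>i\<ge>n. win i = nmem s ''win'' i) \<and> 70 * j + 10 \<le> k' \<and>
     k \<le> k' + 70 * (K - j))" for k' s'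
  have "I k s"
    unfolding I_def
    by (rule exI[of _ "nmem s ''win''"], rule exI[of _ "nmem s ''p''"], rule exI[of _ K])
      (use rep p k in \<open>auto simp: fun_upd_idem\<close>)
  thus ?thesis unfolding tree_up_def
  proof (rule wp_While, goal_cases)
    case (1 k' s')
    thus ?case by (auto simp: I_def)
  next
    case (2 k' s')
    then obtain win p j where s': "s' = s\<lparr>nmem := (nmem s)(''win'' := win, ''p'' := p)\<rparr>"
      and rep: "repaired_below n win (rmem s ''dist'') (p 0)" and p: "1 \<le> p 0" "p 0 < 2 * n"
      and j: "p 0 < 2 ^ Suc j" "j \<le> K" and win: "\<forall>i\<ge>n. win i = nmem s ''win'' i"
      and k': "70 * j + 10 \<le> k'" "k \<le> k' + 70 * (K - j)"
      unfolding I_def by blast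
    have p1: "1 < p 0" using 2(2) by (simp add: s')
    define h where "h = p 0 div 2"
    define win' where "win' = win(h :=
      if 0 < win (2 * h + 1) \<and> \<not> (0 < win (2 * h) \<and>
        \<not> rmem s ''dist'' (win (2 * h + 1) - 1) < rmem s ''dist'' (win (2 * h) - 1))
      then win (2 * h + 1) else win (2 * h))"
    define s'' where "s'' = s\<lparr>nmem := (nmem s)(''win'' := win', ''p'' := p(0 := h))\<rparr>"
    have "j \<noteq> 0" using p1 j(1) by (cases j) auto
    then obtain l where l: "j = Suc l" by (cases j) auto
    have h: "h < n" "1 \<le> h" "h < 2 ^ Suc l" using p p1 j(1) by (auto simp: h_def l)
    have I: "I k'' s''" if "70 * l + 10 \<le> k''" "k \<le> k'' + 70 * (K - l)" for k''
      unfolding I_def s''_def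
      by (rule exI[of _ win'], rule exI[of _ "p(0 := h)"], rule exI[of _ l])
        (use repaired_below_step[OF rep p1 p(2)] h win that j l in \<open>auto simp: win'_def h_def\<close>)
    have hh: "h + h = 2 * h" by simp
    \<comment> \<open>Both branches end in the same state \<open>s''\<close>, since
      \<open>win'\<close> contains the branch condition.\<close>
    show ?case unfolding Let_def
      by (intro wp_Seq wp_NWrite wp_If; (use k' l in simp; fail)?;
        rule subst[of s'' _ "I _"],
        force simp: s''_def s' win'_def h_def[symmetric] fun_upd_twist hh,
        intro I; use k' l j in simp)
  next
    case (3 k' s')
    then obtain win p j where s': "s' = s\<lparr>nmem := (nmem s)(''win'' := win, ''p'' := p)\<rparr>"
      and rep: "repaired_below n win (rmem s ''dist'') (p 0)" and p: "1 \<le> p 0" "p 0 < 2 * n"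
      and j: "p 0 < 2 ^ Suc j" "j \<le> K" and win: "\<forall>i\<ge>n. win i = nmem s ''win'' i"
      and k': "70 * j + 10 \<le> k'" "k \<le> k' + 70 * (K - j)"
      unfolding I_def by blast
    have p1: "p 0 = 1" using 3(2) p by (simp add: s')
    \<comment> \<open>At the root no positive cell is a proper ancestor any more, so nothing is
      exempt.\<close>
    have "p 0 div 2 ^ Suc i = 0" for i using p1 by (simp add: div_mult2_eq)
    hence "\<forall>q\<in>{1..<2 * n}. best n win (rmem s ''dist'') q"
      using rep unfolding repaired_below_def by auto
    hence "tournament n win (rmem s ''dist'')" using p(2) p1 by (auto simp: tournament_def)
    thus ?case unfolding s' using k' j win by (intro post) auto
  qed
qed

section \<open>Looking up an estimate\<close>

context bk_network
begin

lemma estimate_list_sorted: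
  "estimate_list X i xs \<Longrightarrow> a < b \<Longrightarrow> b < length xs \<Longrightarrow> fst (xs ! a) < fst (xs ! b)"
  unfolding estimate_list_def by (simp add: sorted_wrt_iff_nth_less)

lemma estimate_list_nonneg:
  assumes "estimate_list X i xs" "t < length xs"
  shows "0 \<le> fst (xs ! t)"
proof -
  have "\<forall>p\<in>set xs. 0 \<le> fst p" using assms(1) unfolding estimate_list_def by (simp add: split_beta)
  thus ?thesis using assms(2) by simp
qed

lemma estimate_list_find:
  assumes "estimate_list X i xs" "0 \<le> d"
  obtains t where "t < length xs" "fst (xs ! t) \<le> d" "snd (xs ! t) = nhat X i d"
    "\<And>l. l < length xs \<Longrightarrow> fst (xs ! l) \<le> d \<Longrightarrow> fst (xs ! l) \<le> fst (xs ! t)"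
proof -
  have "\<forall>d\<ge>0. \<exists>p\<in>set xs. fst p \<le> d \<and> (\<forall>q\<in>set xs. fst q \<le> d \<longrightarrow> fst q \<le> fst p) \<and> nhat X i d = snd p"
    using assms(1) unfolding estimate_list_def split_beta by (elim conjE)
  then obtain p where p: "p \<in> set xs" "fst p \<le> d" "\<forall>q\<in>set xs. fst q \<le> d \<longrightarrow> fst q \<le> fst p"
    "nhat X i d = snd p" using assms(2) by blast
  then obtain t where "t < length xs" "xs ! t = p" by (auto simp: in_set_conv_nth)
  thus ?thesis using that[of t] p by auto
qed

text \<open>The list is specified by a greatest key, the binary search by an index; strict
  sortedness makes them agree.\<close>

lemma estimate_list_lookup:
  assumes list: "estimate_list X i xs" and l: "l < length xs" "fst (xs ! l) \<le> d"
    and above: "\<And>t. l < t \<Longrightarrow> t < length xs \<Longrightarrow> d < fst (xs ! t)"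
  shows "snd (xs ! l) = nhat X i d"
proof -
  have "0 \<le> d" using estimate_list_nonneg[OF list l(1)] l(2) by simp
  then obtain t where t: "t < length xs" "fst (xs ! t) \<le> d" "snd (xs ! t) = nhat X i d"
    "fst (xs ! l) \<le> fst (xs ! t)" using estimate_list_find[OF list] l by metis
  have "\<not> t < l" using estimate_list_sorted[OF list, of t l] l(1) t(4) by auto
  moreover have "\<not> l < t" using above[of t] t(1,2) by auto
  ultimately have "t = l" by simp
  thus ?thesis using t(3) by simp
qed

text \<open>The pair that answers distance 0 has a key at most 0; keys are nonnegative and strictly
  increasing, so this pair comes first.\<close>

lemma estimate_list_first:
  assumes list: "estimate_list X i xs"
  shows "xs \<noteq> []" and "fst (xs ! 0) = 0" and "snd (xs ! 0) = nhat X i 0"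
proof -
  obtain t where t: "t < length xs" "fst (xs ! t) \<le> 0" "snd (xs ! t) = nhat X i 0"
    using estimate_list_find[OF list, of 0] by auto
  show ne: "xs \<noteq> []" using t(1) by auto
  have "t = 0"
    using estimate_list_sorted[OF list, of 0 t] estimate_list_nonneg[OF list, of 0] t(1,2) ne by force
  thus "fst (xs ! 0) = 0" "snd (xs ! 0) = nhat X i 0"
    using t estimate_list_nonneg[OF list, of 0] by auto
qed

end

definition lookup :: com where
  "lookup = Seq (assign ''lo'' (NConst 0)) (Seq (assign ''hi'' (NRead ''Lsize'' (V ''u'')))
    (Seq
      (While (NLess (NConst 1) (NSub (V ''hi'') (V ''lo'')))
        (Seq (assign ''mid'' (NHalf (NAdd (V ''lo'') (V ''hi''))))
          (If (RLess (RRead ''dist'' (V ''u'')) (RRead ''Lx'' (NAdd (NRead ''Lpos'' (V ''u'')) (V ''mid''))))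
            (assign ''hi'' (V ''mid'')) (assign ''lo'' (V ''mid'')))))
      (RWrite ''pi'' (V ''u'') (RRead ''Ly'' (NAdd (NRead ''Lpos'' (V ''u'')) (V ''lo''))))))"

lemma wp_lookup:
  fixes xs :: "(real \<times> real) list"
  defines "u s \<equiv> nmem s ''u'' 0" and "d s \<equiv> rmem s ''dist'' (nmem s ''u'' 0)"
  assumes size: "nmem s ''Lsize'' (u s) = length xs" "xs \<noteq> []" "length xs \<le> 2 ^ K"
    and entries: "\<And>t. t < length xs \<Longrightarrow> rmem s ''Lx'' (nmem s ''Lpos'' (u s) + t) = fst (xs ! t) \<and>
      rmem s ''Ly'' (nmem s ''Lpos'' (u s) + t) = snd (xs ! t)"
    and sorted: "sorted_wrt (<) (map fst xs)" and first: "fst (xs ! 0) \<le> d s"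
    and k: "40 * K + 40 \<le> k"
    and post: "\<And>k' lo hi mid l. k \<le> k' + (40 * K + 40) \<Longrightarrow> l < length xs \<Longrightarrow> fst (xs ! l) \<le> d s \<Longrightarrow>
      (\<And>t. l < t \<Longrightarrow> t < length xs \<Longrightarrow> d s < fst (xs ! t)) \<Longrightarrow>
      Q k' (s\<lparr>nmem := (nmem s)(''lo'' := lo, ''hi'' := hi, ''mid'' := mid),
        rmem := (rmem s)(''pi'' := (rmem s ''pi'')(u s := snd (xs ! l)))\<rparr>)"
  shows "wp lookup Q k s"
proof -
  \<comment> \<open>The keys at \<open>lo\<close> and \<open>hi\<close> enclose the distance, where
    \<open>hi = length xs\<close> stands for an infinite key. A halving costs at most 40 units; the
    12 cover the two initial assignments, and the 25 the exit test and the final write.\<close>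
  define I where "I k' s' \<longleftrightarrow> (\<exists>lo hi mid j.
     s' = s\<lparr>nmem := (nmem s)(''lo'' := lo, ''hi'' := hi, ''mid'' := mid)\<rparr> \<and>
     lo 0 < hi 0 \<and> hi 0 \<le> length xs \<and> hi 0 - lo 0 \<le> 2 ^ j \<and> j \<le> K \<and> fst (xs ! lo 0) \<le> d s \<and>
     (hi 0 < length xs \<longrightarrow> d s < fst (xs ! hi 0)) \<and>
     40 * j + 25 \<le> k' \<and> k \<le> k' + 40 * (K - j) + 12)" for k' s'
  have mono: "fst (xs ! a) < fst (xs ! b)" if "a < b" "b < length xs" for a b
    using sorted that by (auto simp: sorted_wrt_iff_nth_less)
  have I0: "I (k - 8) (s\<lparr>nmem := (nmem s)(''lo'' := (nmem s ''lo'')(0 := 0),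
      ''hi'' := (nmem s ''hi'')(0 := length xs))\<rparr>)"
    unfolding I_def
    by (rule exI[of _ "(nmem s ''lo'')(0 := 0)"], rule exI[of _ "(nmem s ''hi'')(0 := length xs)"],
        rule exI[of _ "nmem s ''mid''"], rule exI[of _ K])
      (use size first k in \<open>auto simp: fun_upd_twist fun_upd_idem\<close>)
  show ?thesis unfolding lookup_def
  proof (intro wp_Seq wp_NWrite, goal_cases)
    case 1
    show ?case using k by simp
  next
    case 2
    show ?case using k by simp
  next
    case 3
    show ?case
    proof (rule wp_While[where I = I], goal_cases)
      case 1
      show ?case using I0 size by (auto simp: u_def elim!: back_subst[of "\<lambda>x. I x _"])
    next
      case (2 k' s')
      thus ?case by (auto simp: I_def)
    next
      case (3 k' s')
      then obtain lo hi mid j where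
        s': "s' = s\<lparr>nmem := (nmem s)(''lo'' := lo, ''hi'' := hi, ''mid'' := mid)\<rparr>"
        and lohi: "lo 0 < hi 0" "hi 0 \<le> length xs" "fst (xs ! lo 0) \<le> d s"
          "hi 0 < length xs \<longrightarrow> d s < fst (xs ! hi 0)"
        and j: "hi 0 - lo 0 \<le> 2 ^ j" "j \<le> K" and k': "40 * j + 25 \<le> k'" "k \<le> k' + 40 * (K - j) + 12"
        unfolding I_def by blast
      have wide: "1 < hi 0 - lo 0" using 3(2) by (simp add: s')
      hence "j \<noteq> 0" using j(1) by (cases j) auto
      then obtain l where l: "j = Suc l" by (cases j) auto
      define m where "m = (lo 0 + hi 0) div 2"
      \<comment> \<open>A width of at least 2 puts the midpoint strictly inside, and a width of at
        most \<open>2 * 2 ^ l\<close> leaves at most \<open>2 ^ l\<close> on either side, even after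
        rounding.\<close>
      have m: "lo 0 < m" "m < hi 0" "hi 0 - m \<le> 2 ^ l" "m - lo 0 \<le> 2 ^ l"
        using wide lohi(1) j(1) by (auto simp: m_def l)
      have cut_lo: "I k'' (s\<lparr>nmem := (nmem s)(''lo'' := lo(0 := m), ''hi'' := hi, ''mid'' := mid(0 := m))\<rparr>)"
        if "fst (xs ! m) \<le> d s" "40 * l + 25 \<le> k''" "k \<le> k'' + 40 * (K - l) + 12" for k''
        unfolding I_def
        by (rule exI[of _ "lo(0 := m)"], rule exI[of _ hi], rule exI[of _ "mid(0 := m)"], rule exI[of _ l])
          (use that lohi m j l in auto)
      have cut_hi: "I k'' (s\<lparr>nmem := (nmem s)(''lo'' := lo, ''hi'' := hi(0 := m), ''mid'' := mid(0 := m))\<rparr>)"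
        if "d s < fst (xs ! m)" "40 * l + 25 \<le> k''" "k \<le> k'' + 40 * (K - l) + 12" for k''
        unfolding I_def
        by (rule exI[of _ lo], rule exI[of _ "hi(0 := m)"], rule exI[of _ "mid(0 := m)"], rule exI[of _ l])
          (use that lohi m j l in auto)
      have entry: "rmem s ''Lx'' (nmem s ''Lpos'' (nmem s ''u'' 0) + m) = fst (xs ! m)"
        using entries[of m] m lohi by (simp add: u_def)
      show ?case
      proof (intro wp_Seq wp_NWrite wp_If, goal_cases)
        case 4
        have "d s < fst (xs ! m)" using 4(1) entry by (simp add: s' m_def d_def)
        from cut_hi[OF this] show ?case using k' l j
          by (simp add: s' m_def[symmetric] fun_upd_twist)
      next
        case 6
        have "fst (xs ! m) \<le> d s" using 6(1) entry by (simp add: s' m_def d_def)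
        from cut_lo[OF this] show ?case using k' l j
          by (simp add: s' m_def[symmetric] fun_upd_twist)
      qed (use k' l in simp_all)
    next
      case (4 k' s')
      then obtain lo hi mid j where
        s': "s' = s\<lparr>nmem := (nmem s)(''lo'' := lo, ''hi'' := hi, ''mid'' := mid)\<rparr>"
        and lohi: "lo 0 < hi 0" "hi 0 \<le> length xs" "fst (xs ! lo 0) \<le> d s"
          "hi 0 < length xs \<longrightarrow> d s < fst (xs ! hi 0)"
        and j: "hi 0 - lo 0 \<le> 2 ^ j" "j \<le> K" and k': "40 * j + 25 \<le> k'" "k \<le> k' + 40 * (K - j) + 12"
        unfolding I_def by blast
      have hi: "hi 0 = lo 0 + 1" using 4(2) lohi(1) by (simp add: s')
      have above: "d s < fst (xs ! t)" if "lo 0 < t" "t < length xs" for t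
        using that lohi(4) mono[of "hi 0" t] hi by (cases "t = hi 0") auto
      have entry: "rmem s ''Ly'' (nmem s ''Lpos'' (nmem s ''u'' 0) + lo 0) = snd (xs ! lo 0)"
        using entries[of "lo 0"] lohi by (simp add: u_def)
      show ?case
      proof (rule wp_RWrite, goal_cases)
        case 2
        show ?case using post[of _ "lo 0" lo hi mid] k' j lohi above entry
          by (simp add: s' u_def)
      qed (use k' in simp)
    qed
  qed
qed

section \<open>Pruned multi-source search\<close>

lemma tournament_root_empty: "tournament n win d \<Longrightarrow> win 1 = 0 \<Longrightarrow> v < n \<Longrightarrow> win (n + v) = 0"
proof -
  assume t: "tournament n win d" "win 1 = 0" "v < n"
  hence "best n win d 1" by (auto simp: tournament_def)
  with t show ?thesis unfolding best_def leaves_root by (auto split: if_splits)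
qed

lemma tournament_root_min:
  assumes "tournament n win d" "win 1 \<noteq> 0"
  obtains v where "v < n" "win 1 = v + 1" "win (n + v) \<noteq> 0"
    "\<And>w. w < n \<Longrightarrow> win (n + w) \<noteq> 0 \<Longrightarrow> d v \<le> d w"
proof -
  have "best n win d 1" using assms by (auto simp: tournament_def)
  with assms(2) that show ?thesis unfolding best_def leaves_root by (auto split: if_splits)
qed

text \<open>The threshold is an extended real so that \<open>\<infinity>\<close> can switch pruning
  off.\<close>

locale thresholded_search = seeded_network +
  fixes \<theta> :: ereal
begin

abbreviation N :: nat where "N \<equiv> card (nodes X)"
abbreviation E :: "(nat \<times> nat) set" where "E \<equiv> parcs (graph X)"

text \<open>Finiteness of \<open>D v\<close> matters for \<open>\<theta> = \<infinity>\<close>: an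
  unreachable node would satisfy the rank bound, but the search never finds it.\<close>

definition near :: "nat set" where
  "near = {v \<in> nodes X. D v < \<infinity> \<and> est_rank_set X S v \<le> \<theta>}"

definition near_arcs :: "(nat \<times> nat) set" where
  "near_arcs = {e \<in> E. snd e \<in> near}"

lemma finite_arcs: "finite E"
  using pair_fin_digraph.pair_finite_arcs[OF pair_fin_graph] .

lemma arc_nodes: "(v, u) \<in> E \<Longrightarrow> v \<in> nodes X \<and> u \<in> nodes X"
  using pair_fin_graph unfolding pair_fin_digraph_def pair_wf_digraph_def by fastforce

lemma finite_near_arcs: "finite near_arcs"
  using finite_arcs by (simp add: near_arcs_def)

text \<open>This closure lets the pruned search reach all of \<open>near\<close>. Positive lengths
  make \<open>D\<close> drop strictly, which supports induction along tight arcs.\<close>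

lemma near_tight:
  assumes "v \<in> near" "v \<notin> S"
  obtains u where "(v, u) \<in> E" "u \<in> near" "D v = elen X (v, u) + D u" "D u < D v"
proof -
  have fin: "D v < \<infinity>" and rank: "est_rank_set X S v \<le> \<theta>" using assms by (auto simp: near_def)
  obtain u where u: "(v, u) \<in> E" "D v = elen X (v, u) + D u"
    using seed_dist_arc_tight[OF fin assms(2)] by metis
  have "u \<in> near" using u fin est_rank_set_tight_mono[OF fin u] rank arc_nodes[OF u(1)]
    unfolding near_def by (cases "D u") auto
  moreover have "D u < D v"
    using u(2) fin elen_pos[OF u(1)] seed_dist_nonneg[of u] by (cases "D u") auto
  ultimately show ?thesis using that u by blast
qed

text \<open>In \<open>search P Do R\<close>, the nodes in \<open>Do\<close> have their final distance, those in \<open>P\<close> also their rank,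
  and the arcs in \<open>R\<close> have been relaxed. A queued node outside of \<open>near\<close> may carry too large a
  distance, as the search is pruned; it will be rejected by the threshold all the same.\<close>

definition search :: "nat set \<Rightarrow> nat set \<Rightarrow> (nat \<times> nat) set \<Rightarrow> (nat \<Rightarrow> nat) \<Rightarrow> (nat \<Rightarrow> real) \<Rightarrow>
    (nat \<Rightarrow> nat) \<Rightarrow> (nat \<Rightarrow> nat) \<Rightarrow> (nat \<Rightarrow> real) \<Rightarrow> bool" where
  "search P Do R win d done found rk \<longleftrightarrow>
     tournament N win d \<and> S \<subseteq> Do \<and> Do \<subseteq> nodes X \<and> P \<subseteq> Do \<and>
     (\<forall>v\<in>nodes X. done v \<noteq> 0 \<longleftrightarrow> v \<in> Do) \<and>
     (\<forall>v\<in>nodes X. found v \<noteq> 0 \<longleftrightarrow> v \<in> P \<inter> near) \<and>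
     (\<forall>v\<in>P \<inter> near. ereal (rk v) = est_rank_set X S v) \<and>
     (\<forall>v\<in>nodes X. win (N + v) \<noteq> 0 \<longrightarrow> v \<notin> Do) \<and>
     (\<forall>v\<in>nodes X. win (N + v) \<noteq> 0 \<or> v \<in> Do \<longrightarrow> D v \<le> ereal (d v)) \<and>
     (\<forall>v\<in>Do \<inter> near. D v = ereal (d v)) \<and>
     R \<subseteq> near_arcs \<and>
     (\<forall>(v, u)\<in>R. u \<in> Do \<and> (v \<notin> Do \<longrightarrow> win (N + v) \<noteq> 0 \<and> d v \<le> elen X (v, u) + d u))"

definition queued :: "(nat \<Rightarrow> nat) \<Rightarrow> nat set" where
  "queued win = {v. v < N \<and> win (N + v) \<noteq> 0}"

lemma finite_queued: "finite (queued win)"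
  by (simp add: queued_def)

text \<open>The zero in \<open>dist\<close> is already the exact distance of every seed, and no leaf
  is queued.\<close>

lemma search_init:
  assumes "\<And>v. v \<in> nodes X \<Longrightarrow> done v \<noteq> 0 \<longleftrightarrow> v \<in> S"
  shows "search {} S {} (\<lambda>_. 0) (\<lambda>_. 0) done (\<lambda>_. 0) rk"
  using assms seeds_subset seed_dist_seed
  unfolding search_def tournament_def best_def
  by (auto simp: zero_ereal_def)

lemma search_relax_done:
  assumes "search P Do R win d done found rk" "(i, u) \<in> near_arcs" "u \<in> Do" "i \<in> Do"
  shows "search P Do (insert (i, u) R) win d done found rk"
  using assms unfolding search_def by auto

lemma search_relax_keep:
  assumes "search P Do R win d done found rk" "(i, u) \<in> near_arcs" "u \<in> Do"
    and "win (N + i) \<noteq> 0" "d i \<le> elen X (i, u) + d u"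
  shows "search P Do (insert (i, u) R) win d done found rk"
  using assms unfolding search_def by auto

text \<open>Only the key of \<open>i\<close> changes, and \<open>i\<close> is not in
  \<open>Do\<close>, so final distances and the right-hand sides of relaxed arcs are untouched. The
  key decreases, or \<open>i\<close> was not queued, and then no arc of \<open>R\<close> leaves
  \<open>i\<close>.\<close>

lemma search_relax_update:
  assumes inv: "search P Do R win d done found rk" and arc: "(i, u) \<in> near_arcs" "u \<in> Do" "i \<notin> Do"
    and better: "win (N + i) = 0 \<or> elen X (i, u) + d u < d i"
    and tour: "tournament N win' (d(i := elen X (i, u) + d u))"
    and win': "\<And>j. N \<le> j \<Longrightarrow> win' j = (win(N + i := i + 1)) j"
  shows "search P Do (insert (i, u) R) win' (d(i := elen X (i, u) + d u)) done found rk"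
proof -
  have u: "u \<in> near" "(i, u) \<in> E" using arc by (auto simp: near_arcs_def)
  have du: "D u = ereal (d u)" using inv arc u unfolding search_def by blast
  have Di: "D i \<le> ereal (elen X (i, u) + d u)" using seed_dist_arc_le[OF u(2)] du by simp
  have leaf: "win' (N + v) = (if v = i then i + 1 else win (N + v))" for v by (simp add: win')
  have ui: "u \<noteq> i" using arc by blast
  have R: "u' \<in> Do \<and> (v \<notin> Do \<longrightarrow> win' (N + v) \<noteq> 0 \<and>
      (d(i := elen X (i, u) + d u)) v \<le> elen X (v, u') + (d(i := elen X (i, u) + d u)) u')"
    if "(v, u') \<in> insert (i, u) R" for v u'
  proof (cases "(v, u') = (i, u)")
    case True
    thus ?thesis using arc ui leaf by auto
  next
    case False
    hence "(v, u') \<in> R" using that by blast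
    hence *: "u' \<in> Do \<and> (v \<notin> Do \<longrightarrow> win (N + v) \<noteq> 0 \<and> d v \<le> elen X (v, u') + d u')"
      using inv unfolding search_def by blast
    hence "u' \<noteq> i" using arc by blast
    thus ?thesis using * better leaf by auto
  qed
  have last: "\<forall>(v, u')\<in>insert (i, u) R. u' \<in> Do \<and> (v \<notin> Do \<longrightarrow> win' (N + v) \<noteq> 0 \<and>
      (d(i := elen X (i, u) + d u)) v \<le> elen X (v, u') + (d(i := elen X (i, u) + d u)) u')"
    using R by blast
  show ?thesis
    using inv arc Di tour last unfolding search_def
    by (elim conjE, intro conjI) (assumption | (auto simp: leaf; fail))+
qed

lemma search_visit:
  assumes inv: "search P Do R win d done found rk" and u: "u \<in> Do" "u \<notin> P"
    and rk: "rk u = nhat X u y" "D u \<le> ereal y" "u \<in> near \<Longrightarrow> D u = ereal y"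
    and found': "found' = (if ereal (rk u) \<le> \<theta> then found(u := 1) else found)"
  shows "search (insert u P) Do R win d done found' rk" and "ereal (rk u) \<le> \<theta> \<longleftrightarrow> u \<in> near"
proof -
  have un: "u \<in> nodes X" using inv u unfolding search_def by auto
  obtain a where a: "D u = ereal a" "a \<le> y"
    using rk(2) seed_dist_nonneg[of u] by (cases "D u") auto
  have rank: "est_rank_set X S u = ereal (nhat X u a)" using a by (simp add: est_rank_set_eq)
  have eq: "u \<in> near \<Longrightarrow> a = y" using rk(3) a by simp
  show near: "ereal (rk u) \<le> \<theta> \<longleftrightarrow> u \<in> near"
  proof
    assume "ereal (rk u) \<le> \<theta>"
    moreover have "nhat X u a \<le> rk u" using nhat_mono[OF a(2)] rk(1) by simp
    ultimately have "ereal (nhat X u a) \<le> \<theta>" by (meson ereal_less_eq(3) order_trans)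
    thus "u \<in> near" using un a rank by (simp add: near_def)
  next
    assume "u \<in> near"
    thus "ereal (rk u) \<le> \<theta>" using eq rk(1) rank by (simp add: near_def)
  qed
  have "ereal (rk u) = est_rank_set X S u" if "u \<in> near" using eq[OF that] rk(1) rank by simp
  thus "search (insert u P) Do R win d done found' rk"
    using inv u near unfolding search_def found' by auto
qed

lemma search_set_rank:
  "search P Do R win d done found rk \<Longrightarrow> u \<notin> P \<Longrightarrow> search P Do R win d done found (rk(u := x))"
  unfolding search_def by auto

section \<open>Optimality of the extracted minimum\<close>

abbreviation in_arcs_of :: "nat set \<Rightarrow> (nat \<times> nat) set" where
  "in_arcs_of A \<equiv> {e \<in> near_arcs. snd e \<in> A}"

text \<open>Follow tight arcs from \<open>v\<close> within \<open>near\<close> until the head of an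
  arc is done, at the latest at a seed. That arc has been relaxed, so its tail is queued with a key
  at most its own seed distance, hence at most \<open>D v\<close>.\<close>

lemma queued_before:
  assumes inv: "search P Do (in_arcs_of Do) win d done found rk" and "v \<in> near" "v \<notin> Do"
  shows "\<exists>x\<in>nodes X. win (N + x) \<noteq> 0 \<and> ereal (d x) \<le> D v"
  using assms(2,3)
\<comment> \<open>Real distances are not well-founded; the induction counts the nodes closer to the
  seeds instead.\<close>
proof (induction "card {w \<in> nodes X. D w < D v}" arbitrary: v rule: less_induct)
  case less
  have "v \<notin> S" using inv less.prems unfolding search_def by blast
  with less.prems obtain u where u: "(v, u) \<in> E" "u \<in> near" "D v = elen X (v, u) + D u" "D u < D v"
    using near_tight by metis
  show ?case
  proof (cases "u \<in> Do")
    case True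
    have "(v, u) \<in> in_arcs_of Do" using u True by (simp add: near_arcs_def)
    hence "win (N + v) \<noteq> 0 \<and> d v \<le> elen X (v, u) + d u" using inv less.prems unfolding search_def by blast
    moreover have "D u = ereal (d u)" using inv u True unfolding search_def by blast
    ultimately show ?thesis using u(3) less.prems by (intro bexI[of _ v]) (auto simp: near_def)
  next
    case False
    have "u \<in> nodes X" using u by (simp add: near_def)
    hence "{w \<in> nodes X. D w < D u} \<subset> {w \<in> nodes X. D w < D v}" using u(4) by auto
    moreover have "finite (nodes X)" using pair_fin_digraph.pair_finite_verts[OF pair_fin_graph] .
    ultimately have "card {w \<in> nodes X. D w < D u} < card {w \<in> nodes X. D w < D v}"
      by (intro psubset_card_mono) auto
    from less.hyps[OF this u(2) False] u(4) show ?thesis by (meson less_imp_le order_trans)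
  qed
qed

lemma search_pop:
  assumes inv: "search P Do (in_arcs_of Do) win d done found rk"
    and u: "u < N" "win (N + u) \<noteq> 0" "\<And>w. w < N \<Longrightarrow> win (N + w) \<noteq> 0 \<Longrightarrow> d u \<le> d w"
    and tour: "tournament N win' d" and win': "\<And>j. N \<le> j \<Longrightarrow> win' j = (win(N + u := 0)) j"
  shows "search P (insert u Do) (in_arcs_of Do) win' d (done(u := 1)) found rk"
proof -
  have un: "u \<in> nodes X" using u node_iff by blast
  have uDo: "u \<notin> Do" and Du: "D u \<le> ereal (d u)" using inv u un unfolding search_def by auto
  have leaf: "win' (N + v) = (if v = u then 0 else win (N + v))" for v by (simp add: win')
  \<comment> \<open>Some queued key is at most \<open>D u\<close> by \<open>queued_before\<close>,
    and the key of \<open>u\<close> is the least of all. Outside of \<open>near\<close> only the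
    upper bound \<open>Du\<close> survives.\<close>
  have exact: "D u = ereal (d u)" if near: "u \<in> near"
  proof (rule antisym[OF Du])
    obtain x where x: "x \<in> nodes X" "win (N + x) \<noteq> 0" "ereal (d x) \<le> D u"
      using queued_before[OF inv near uDo] by blast
    have "d u \<le> d x" using u(3) x node_iff by blast
    thus "ereal (d u) \<le> D u" using x(3) by (meson ereal_less_eq(3) order_trans)
  qed
  have *: "S \<subseteq> Do" "Do \<subseteq> nodes X" "P \<subseteq> Do"
    and done_iff: "\<forall>v\<in>nodes X. done v \<noteq> 0 \<longleftrightarrow> v \<in> Do"
    and found: "\<forall>v\<in>nodes X. found v \<noteq> 0 \<longleftrightarrow> v \<in> P \<inter> near"
    and rank: "\<forall>v\<in>P \<inter> near. ereal (rk v) = est_rank_set X S v"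
    and opened: "\<forall>v\<in>nodes X. win (N + v) \<noteq> 0 \<longrightarrow> v \<notin> Do"
    and bound: "\<forall>v\<in>nodes X. win (N + v) \<noteq> 0 \<or> v \<in> Do \<longrightarrow> D v \<le> ereal (d v)"
    and tight: "\<forall>v\<in>Do \<inter> near. D v = ereal (d v)"
    and arcs: "\<forall>(v, u)\<in>in_arcs_of Do. u \<in> Do \<and>
      (v \<notin> Do \<longrightarrow> win (N + v) \<noteq> 0 \<and> d v \<le> elen X (v, u) + d u)"
    using inv unfolding search_def by simp_all
  have "\<forall>v\<in>nodes X. win' (N + v) \<noteq> 0 \<longrightarrow> v \<notin> insert u Do" using opened leaf by simp
  moreover have "\<forall>v\<in>nodes X. win' (N + v) \<noteq> 0 \<or> v \<in> insert u Do \<longrightarrow> D v \<le> ereal (d v)"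
    using bound leaf Du by simp
  moreover have "\<forall>v\<in>insert u Do \<inter> near. D v = ereal (d v)" using tight exact by blast
  moreover have "\<forall>(v, w)\<in>in_arcs_of Do. w \<in> insert u Do \<and>
      (v \<notin> insert u Do \<longrightarrow> win' (N + v) \<noteq> 0 \<and> d v \<le> elen X (v, w) + d w)"
    using arcs leaf by fastforce
  moreover have "\<forall>v\<in>nodes X. (done(u := 1)) v \<noteq> 0 \<longleftrightarrow> v \<in> insert u Do" using done_iff by simp
  moreover have "S \<subseteq> insert u Do" "insert u Do \<subseteq> nodes X" "P \<subseteq> insert u Do"
    "in_arcs_of Do \<subseteq> near_arcs" using * un by auto
  ultimately show ?thesis
    using found rank tour unfolding search_def by (intro conjI) assumption+
qed

text \<open>By \<open>queued_before\<close>, an unfinished near node would force a queued one, which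
  an empty root excludes.\<close>

lemma search_final:
  assumes inv: "search Do Do (in_arcs_of Do) win d done found rk" and "win 1 = 0" and v: "v \<in> nodes X"
  shows "found v \<noteq> 0 \<longleftrightarrow> v \<in> near" and "v \<in> near \<Longrightarrow> ereal (rk v) = est_rank_set X S v"
proof -
  have tour: "tournament N win d" and found: "\<forall>v\<in>nodes X. found v \<noteq> 0 \<longleftrightarrow> v \<in> Do \<inter> near"
    and rank: "\<forall>v\<in>Do \<inter> near. ereal (rk v) = est_rank_set X S v"
    using inv unfolding search_def by simp_all
  have Do: "w \<in> Do" if w: "w \<in> near" for w
  proof (rule ccontr)
    assume "w \<notin> Do"
    then obtain x where "x \<in> nodes X" "win (N + x) \<noteq> 0" using queued_before[OF inv w] by blast
    thus False using tournament_root_empty[OF tour assms(2), of x] by (simp add: node_iff[symmetric])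
  qed
  show "found v \<noteq> 0 \<longleftrightarrow> v \<in> near" using bspec[OF found v] Do[of v] by blast
  show "ereal (rk v) = est_rank_set X S v" if "v \<in> near"
    using bspec[OF rank, of v] Do[OF that] that by blast
qed

lemma card_queued_insert:
  assumes "\<And>j. N \<le> j \<Longrightarrow> win' j = (win(N + i := x)) j"
  shows "card (queued win') \<le> card (queued win) + 1"
proof -
  have "queued win' \<subseteq> insert i (queued win)" using assms by (auto simp: queued_def split: if_splits)
  hence "card (queued win') \<le> card (insert i (queued win))" using finite_queued by (intro card_mono) auto
  also have "\<dots> \<le> card (queued win) + 1" by (simp add: card_insert_if finite_queued)
  finally show ?thesis .
qed

lemma card_queued_remove:
  assumes "\<And>j. N \<le> j \<Longrightarrow> win' j = (win(N + i := 0)) j" "i \<in> queued win"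
  shows "card (queued win') + 1 = card (queued win)"
proof -
  have "queued win' = queued win - {i}" using assms by (auto simp: queued_def split: if_splits)
  thus ?thesis using card_Suc_Diff1[OF finite_queued assms(2)] by simp
qed

end

section \<open>The program\<close>

text \<open>Queue membership is read off the leaf cell, because the initial zero in
  \<open>dist\<close> cannot play the role of an infinite distance.\<close>

definition relax :: com where
  "relax = Seq (assign ''i'' (NRead ''src'' (V ''e'')))
    (If (NLess (NRead ''done'' (V ''i'')) (NConst 1))
      (let c = RAdd (RRead ''elen'' (V ''e'')) (RRead ''dist'' (V ''u'')) in
       If (BAnd (NLess (NConst 0) (NRead ''win'' (NAdd (V ''n'') (V ''i''))))
             (BNot (RLess c (RRead ''dist'' (V ''i'')))))
         Skip
         (Seq (RWrite ''dist'' (V ''i'') c)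
           (Seq (assign ''p'' (NAdd (V ''n'') (V ''i'')))
             (Seq (NWrite ''win'' (V ''p'') (NAdd (V ''i'') (NConst 1))) tree_up))))
      Skip)"

definition expand :: "bexp \<Rightarrow> com" where
  "expand tst = If tst
    (Seq (NWrite ''found'' (V ''u'') (NConst 1))
      (Seq (assign ''e'' (NRead ''inpos'' (V ''u'')))
        (Seq (assign ''end'' (NAdd (V ''e'') (NRead ''indeg'' (V ''u''))))
          (While (NLess (V ''e'') (V ''end''))
            (Seq relax (assign ''e'' (NAdd (V ''e'') (NConst 1))))))))
    Skip"

text \<open>The first loop marks all seeds as done before any is expanded, so that an arc between
  seeds never queues a seed.\<close>

definition main :: "bexp \<Rightarrow> com" where
  "main tst = Seq
    (While (NLess (V ''t'') (V ''nseeds''))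
      (Seq (NWrite ''done'' (NRead ''seed'' (V ''t'')) (NConst 1)) (assign ''t'' (NAdd (V ''t'') (NConst 1)))))
    (Seq (assign ''t'' (NConst 0))
    (Seq (While (NLess (V ''t'') (V ''nseeds''))
      (Seq (assign ''u'' (NRead ''seed'' (V ''t'')))
      (Seq (RWrite ''pi'' (V ''u'') (RRead ''Ly'' (NRead ''Lpos'' (V ''u''))))
      (Seq (expand tst) (assign ''t'' (NAdd (V ''t'') (NConst 1)))))))
    (While (NLess (NConst 0) (NRead ''win'' (NConst 1)))
      (Seq (assign ''u'' (NSub (NRead ''win'' (NConst 1)) (NConst 1)))
      (Seq (NWrite ''done'' (V ''u'') (NConst 1))
      (Seq (assign ''p'' (NAdd (V ''n'') (V ''u'')))
      (Seq (NWrite ''win'' (V ''p'') (NConst 0))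
      (Seq tree_up (Seq lookup (expand tst))))))))))"

text \<open>The test is known only through its meaning and its cost, and may rely on the cell
  \<open>T\<close> being preserved. \<open>K\<close> bounds both the tree depth and the number of
  halvings in a lookup.\<close>

locale search_run = thresholded_search +
  fixes L :: "nat \<Rightarrow> (real \<times> real) list" and s0 :: state and tst :: bexp and K :: nat
  assumes lists: "\<And>j. j \<in> nodes X \<Longrightarrow> estimate_list X j (L j)"
    and input: "input_memory X S L s0"
    and nodes_le: "N \<le> 2 ^ K"
    and tst: "\<And>s. rmem s ''T'' 0 = rmem s0 ''T'' 0 \<Longrightarrow>
      bval tst s \<longleftrightarrow> ereal (rmem s ''pi'' (nmem s ''u'' 0)) \<le> \<theta>"
    and tst_cost: "bcost tst \<le> 10"
begin

definition same_input :: "state \<Rightarrow> bool" where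
  "same_input s \<longleftrightarrow>
     (\<forall>a\<in>{''n'', ''nseeds'', ''seed'', ''indeg'', ''inpos'', ''src'', ''Lsize'', ''Lpos''}. nmem s a = nmem s0 a) \<and>
     (\<forall>a\<in>{''elen'', ''Lx'', ''Ly'', ''T''}. rmem s a = rmem s0 a)"

definition valid :: "nat set \<Rightarrow> nat set \<Rightarrow> (nat \<times> nat) set \<Rightarrow> state \<Rightarrow> bool" where
  "valid P Do R s \<longleftrightarrow> same_input s \<and>
     search P Do R (nmem s ''win'') (rmem s ''dist'') (nmem s ''done'') (nmem s ''found'') (rmem s ''pi'')"

abbreviation qsize :: "state \<Rightarrow> nat" where
  "qsize s \<equiv> card (queued (nmem s ''win''))"

lemma n_cell: "same_input s \<Longrightarrow> nmem s ''n'' 0 = N"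
  using input by (simp add: same_input_def input_memory_def)

section \<open>Correctness and amortised cost of the commands\<close>

lemma wp_relax:
  assumes I: "valid P Do R s" and arc: "(i, u) \<in> near_arcs" "u \<in> Do" and u: "nmem s ''u'' 0 = u"
    and e: "nmem s ''src'' (nmem s ''e'' 0) = i" "rmem s ''elen'' (nmem s ''e'' 0) = elen X (i, u)"
    and k: "70 * K + 100 \<le> k"
    and post: "\<And>k' s'. k \<le> k' + (70 * K + 100) \<Longrightarrow> valid P Do (insert (i, u) R) s' \<Longrightarrow>
      qsize s' \<le> qsize s + 1 \<Longrightarrow> \<forall>x\<in>{''u'', ''e'', ''end'', ''t''}. nmem s' x = nmem s x \<Longrightarrow> Q k' s'"
  shows "wp relax Q k s"
proof -
  define s1 where "s1 = s\<lparr>nmem := (nmem s)(''i'' := (nmem s ''i'')(0 := i))\<rparr>"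
  have same: "same_input s" and search: "search P Do R (nmem s ''win'') (rmem s ''dist'')
      (nmem s ''done'') (nmem s ''found'') (rmem s ''pi'')" using I by (auto simp: valid_def)
  have i: "i \<in> nodes X" "i < N" using arc arc_nodes[of i u] node_iff by (auto simp: near_arcs_def)
  have done_iff: "nmem s ''done'' i \<noteq> 0 \<longleftrightarrow> i \<in> Do" using search i(1) unfolding search_def by simp
  have keep: "valid P Do (insert (i, u) R) s1"
    if "search P Do (insert (i, u) R) (nmem s ''win'') (rmem s ''dist'')
      (nmem s ''done'') (nmem s ''found'') (rmem s ''pi'')"
    using that same by (simp add: valid_def s1_def same_input_def)
  show ?thesis
    unfolding relax_def Let_def
  proof (intro wp_Seq wp_NWrite wp_RWrite wp_If wp_Skip, goal_cases)
    \<comment> \<open>\<open>i\<close> is queued with a key that is at least as good.\<close>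
    case 5
    from 5(1,2) have "valid P Do (insert (i, u) R) s1"
      using i e u n_cell[OF same] arc
      by (intro keep search_relax_keep[OF search arc]) (auto simp: s1_def)
    thus ?case using k e(1)
      by (intro post) (auto simp: s1_def[symmetric], auto simp: s1_def)
  next
    \<comment> \<open>\<open>i\<close> enters the queue or its key improves.\<close>
    case 9
    let ?d = "elen X (i, u) + rmem s ''dist'' u"
    have notDo: "i \<notin> Do" using 9(1) e done_iff by simp
    have better: "nmem s ''win'' (N + i) = 0 \<or> ?d < rmem s ''dist'' i"
      using 9(2) e u n_cell[OF same] by auto
    have rep: "repaired_below N ((nmem s ''win'')(N + i := i + 1)) ((rmem s ''dist'')(i := ?d)) (N + i)"
      using search i by (intro repaired_below_leaf) (auto simp: search_def)
    show ?case
    proof (rule wp_tree_up[where n = N and K = K], goal_cases)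
      case 1
      show ?case using rep e u n_cell[OF same] by simp
    next
      case (6 k' win p)
      have win: "win j = ((nmem s ''win'')(N + i := i + 1)) j" if "N \<le> j" for j
        using 6(3) that e u n_cell[OF same] by simp
      have tour: "tournament N win ((rmem s ''dist'')(i := ?d))"
        using 6(2) e u n_cell[OF same] by simp
      from search_relax_update[OF search arc notDo better tour win]
      show ?case using 6(1) k e u card_queued_insert[of win "nmem s ''win''", OF win] same
        by (intro post) (auto simp: valid_def same_input_def)
    qed (use i k e u n_cell[OF same] nodes_le in auto)
  next
    \<comment> \<open>\<open>i\<close> already has its final distance.\<close>
    case 11
    have "i \<in> Do" using 11(1) e done_iff by simp
    hence "valid P Do (insert (i, u) R) s1" by (intro keep search_relax_done[OF search arc])
    thus ?case using k e(1)
      by (intro post) (auto simp: s1_def[symmetric], auto simp: s1_def)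
  qed (use k in simp_all)
qed


text \<open>The first summand pays for relaxing the remaining arcs, including a possible insertion; the second
  one pays for removing the queued nodes.\<close>

definition credit :: "(nat \<times> nat) set \<Rightarrow> state \<Rightarrow> nat" where
  "credit R s = (200 * K + 400) * card (near_arcs - R) + (120 * K + 200) * qsize s"

text \<open>An arc releases \<open>200 * K + 400\<close>. Of this, \<open>120 * K + 200\<close> is
  deposited on a possibly new queue entry; the rest covers \<open>wp_relax\<close> and the loop
  overhead.\<close>

lemma credit_relax:
  assumes "a \<in> near_arcs" "a \<notin> R" "qsize s' \<le> qsize s + 1"
  shows "credit (insert a R) s' + (80 * K + 200) \<le> credit R s"
proof -
  have "near_arcs - R = insert a (near_arcs - insert a R)" using assms by blast
  hence c: "card (near_arcs - R) = card (near_arcs - insert a R) + 1"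
    using finite_near_arcs by (metis Diff_iff Suc_eq_plus1 card_insert_disjoint finite_Diff insertI1)
  have "(120 * K + 200) * qsize s' \<le> (120 * K + 200) * (qsize s + 1)" using assms by (intro mult_le_mono) auto
  thus ?thesis unfolding credit_def c by (simp add: distrib_left)
qed

text \<open>The released amount covers \<open>70 * K + 10\<close> for \<open>tree_up\<close>,
  \<open>40 * K + 40\<close> for \<open>lookup\<close>, and the constant cost of a round.\<close>

lemma credit_pop:
  "qsize s' + 1 = qsize s \<Longrightarrow> credit R s' + (120 * K + 200) = credit R s"
  unfolding credit_def by (simp add: distrib_left flip: Suc_eq_plus1) (metis Suc_eq_plus1 mult_Suc_right add.commute)

text \<open>One postcondition fits both outcomes: if the test fails, no arc of
  \<open>near_arcs\<close> enters \<open>u\<close>, so the added set is empty. \<open>x\<close> is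
  the part of the budget reserved for the caller.\<close>

lemma wp_expand:
  assumes I: "valid P Do R s" and u: "nmem s ''u'' 0 = u" "u \<in> Do" "u \<notin> P"
    and rank: "rmem s ''pi'' u = nhat X u y" "D u \<le> ereal y" "u \<in> near \<Longrightarrow> D u = ereal y"
    and R: "\<And>v. (v, u) \<notin> R"
    and k: "credit R s + x + 60 \<le> k"
    and post: "\<And>k' s'. valid (insert u P) Do (R \<union> {e \<in> near_arcs. snd e = u}) s' \<Longrightarrow>
      credit (R \<union> {e \<in> near_arcs. snd e = u}) s' + x \<le> k' \<Longrightarrow> nmem s' ''t'' = nmem s ''t'' \<Longrightarrow> Q k' s'"
  shows "wp (expand tst) Q k s"
proof -
  have same: "same_input s" and search: "search P Do R (nmem s ''win'') (rmem s ''dist'')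
      (nmem s ''done'') (nmem s ''found'') (rmem s ''pi'')" using I by (auto simp: valid_def)
  note visit = search_visit[OF search u(2,3) rank refl]
  have un: "u \<in> nodes X" using search u(2) unfolding search_def by blast
  have T: "rmem s ''T'' 0 = rmem s0 ''T'' 0" using same by (simp add: same_input_def)
  have tst_iff: "bval tst s \<longleftrightarrow> u \<in> near" using tst[OF T] visit(2) u(1) by simp
  obtain "is" where is_arcs: "distinct is" "set is = {i. (i, u) \<in> E}"
    and indeg: "nmem s0 ''indeg'' u = length is"
    and src: "\<And>t. t < length is \<Longrightarrow> nmem s0 ''src'' (nmem s0 ''inpos'' u + t) = is ! t"
    and elen: "\<And>t. t < length is \<Longrightarrow> rmem s0 ''elen'' (nmem s0 ''inpos'' u + t) = elen X (is ! t, u)"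
    using input un unfolding input_memory_def by metis
  define first where "first = nmem s0 ''inpos'' u"
  define Rj where "Rj j = R \<union> (\<lambda>l. (is ! l, u)) ` {..<j}" for j
  define J where "J k' s' \<longleftrightarrow> (\<exists>j\<le>length is. nmem s' ''e'' 0 = first + j \<and>
     nmem s' ''end'' 0 = first + length is \<and> nmem s' ''u'' 0 = u \<and> nmem s' ''t'' = nmem s ''t'' \<and>
     valid (insert u P) Do (Rj j) s' \<and> credit (Rj j) s' + x + 10 \<le> k')" for k' s'
  show ?thesis unfolding expand_def
  proof (rule wp_If, goal_cases)
    case 1
    show ?case using k tst_cost by simp
  next
    case 2
    hence near: "u \<in> near" using tst_iff by simp
    have all: "Rj (length is) = R \<union> {e \<in> near_arcs. snd e = u}"
    proof -
      have "(\<lambda>l. (is ! l, u)) ` {..<length is} = (\<lambda>i. (i, u)) ` set is"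
        by (auto simp: in_set_conv_nth image_iff)
      also have "\<dots> = {e \<in> near_arcs. snd e = u}"
        unfolding is_arcs(2) near_arcs_def using near by force
      finally show ?thesis by (simp add: Rj_def)
    qed
    have rank_le: "ereal (rmem s ''pi'' u) \<le> \<theta>" using near visit(2) by simp
    show ?case
    proof (intro wp_Seq wp_NWrite, goal_cases)
      case 4
      show ?case
      proof (rule wp_While[where I = J], goal_cases)
        case 1
        show ?case unfolding J_def
          using same u(1) indeg visit(1) rank_le k tst_cost
          by (intro exI[of _ 0]) (auto simp: same_input_def valid_def Rj_def first_def credit_def)
      next
        case (2 k' s')
        thus ?case by (auto simp: J_def)
      next
        case (3 k' s')
        then obtain j where j: "nmem s' ''e'' 0 = first + j" "nmem s' ''end'' 0 = first + length is"
          "nmem s' ''u'' 0 = u" "nmem s' ''t'' = nmem s ''t''"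
          and inv': "valid (insert u P) Do (Rj j) s'" and credit: "credit (Rj j) s' + x + 10 \<le> k'"
          unfolding J_def by blast
        have jl: "j < length is" using 3(2) j by simp
        have same': "same_input s'" using inv' by (simp add: valid_def)
        have arc: "(is ! j, u) \<in> near_arcs"
          using is_arcs(2) nth_mem[OF jl] near by (auto simp: near_arcs_def)
        \<comment> \<open>The credit of an arc is spent only once: no arc into \<open>u\<close> was
          relaxed before, and \<open>is\<close> has no repetitions.\<close>
        have new: "(is ! j, u) \<notin> Rj j"
          using R is_arcs(1) jl by (auto simp: Rj_def nth_eq_iff_index_eq)
        have Suc: "insert (is ! j, u) (Rj j) = Rj (Suc j)" by (auto simp: Rj_def lessThan_Suc)
        have enough: "80 * K + 200 + x + 10 \<le> k'"
          using credit_relax[OF arc new, of s' s'] credit by simp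
        show ?case
        proof (intro wp_Seq wp_relax[OF inv' arc u(2) j(3)], goal_cases)
          case (4 k'' s'')
          show ?case
          proof (rule wp_NWrite, goal_cases)
            case 1
            show ?case using 4(1) enough by simp
          next
            case 2
            have "valid (insert u P) Do (Rj (Suc j)) s''" using 4(2) Suc by simp
            moreover have "credit (Rj (Suc j)) s'' + (80 * K + 200) \<le> credit (Rj j) s'"
              using credit_relax[OF arc new 4(3)] Suc by simp
            ultimately show ?case unfolding J_def using 4(1,4) j jl credit
              by (intro exI[of _ "Suc j"]) (auto simp: valid_def same_input_def credit_def)
          qed
        qed (use same' j src[OF jl] elen[OF jl] enough in \<open>auto simp: same_input_def first_def\<close>)
      next
        case (4 k' s')
        then obtain j where "j \<le> length is" "nmem s' ''e'' 0 = first + j"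
          "nmem s' ''end'' 0 = first + length is" and t: "nmem s' ''t'' = nmem s ''t''"
          and inv': "valid (insert u P) Do (Rj j) s'" and credit: "credit (Rj j) s' + x + 10 \<le> k'"
          unfolding J_def by blast
        with 4(2) have "j = length is" by simp
        with inv' credit t show ?case by (intro post) (auto simp: all)
      qed
    qed (use k tst_cost in simp_all)
  next
    case 3
    hence far: "u \<notin> near" using tst_iff by simp
    have none: "R \<union> {e \<in> near_arcs. snd e = u} = R" using far by (auto simp: near_arcs_def)
    have "\<not> ereal (rmem s ''pi'' u) \<le> \<theta>" using far visit(2) by simp
    hence "valid (insert u P) Do R s" using visit(1) same by (simp add: valid_def)
    thus ?case using k tst_cost by (intro wp_Skip post) (auto simp: none)
  qed
qed


lemma wp_seed_flags:
  assumes xs: "distinct xs" "nmem s0 ''nseeds'' 0 = length xs" "\<And>t. t < length xs \<Longrightarrow> nmem s0 ''seed'' t = xs ! t"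
    and k: "30 * length xs + x + 10 \<le> k"
    and post: "\<And>k' dn t. (\<forall>v. dn v \<noteq> 0 \<longleftrightarrow> v \<in> set xs) \<Longrightarrow> x \<le> k' \<Longrightarrow>
      Q k' (s0\<lparr>nmem := (nmem s0)(''done'' := dn, ''t'' := t)\<rparr>)"
  shows "wp (While (NLess (V ''t'') (V ''nseeds''))
      (Seq (NWrite ''done'' (NRead ''seed'' (V ''t'')) (NConst 1)) (assign ''t'' (NAdd (V ''t'') (NConst 1)))))
    Q k s0"
proof -
  define J where "J k' s' \<longleftrightarrow> (\<exists>dn t. s' = s0\<lparr>nmem := (nmem s0)(''done'' := dn, ''t'' := t)\<rparr> \<and>
    t 0 \<le> length xs \<and> (\<forall>v. dn v \<noteq> 0 \<longleftrightarrow> v \<in> set (take (t 0) xs)) \<and>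
    30 * (length xs - t 0) + x + 10 \<le> k')" for k' s'
  have zero: "nmem s0 ''t'' i = 0" "nmem s0 ''done'' i = 0" for i
    using input unfolding input_memory_def by auto
  show ?thesis
  proof (rule wp_While[where I = J], goal_cases)
    case 1
    show ?case unfolding J_def using k zero
      by (intro exI[of _ "nmem s0 ''done''"] exI[of _ "nmem s0 ''t''"]) auto
  next
    case (2 k' s')
    thus ?case by (auto simp: J_def)
  next
    case (3 k' s')
    then obtain dn t where s': "s' = s0\<lparr>nmem := (nmem s0)(''done'' := dn, ''t'' := t)\<rparr>"
      and dn: "\<forall>v. dn v \<noteq> 0 \<longleftrightarrow> v \<in> set (take (t 0) xs)" and k': "30 * (length xs - t 0) + x + 10 \<le> k'"
      unfolding J_def by blast
    have t: "t 0 < length xs" using 3(2) xs by (simp add: s')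
    define u where "u = xs ! t 0"
    have new: "J k'' (s0\<lparr>nmem := (nmem s0)(''done'' := dn(u := 1), ''t'' := t(0 := t 0 + 1))\<rparr>)"
      if "30 * (length xs - Suc (t 0)) + x + 10 \<le> k''" for k''
      unfolding J_def
      by (rule exI[of _ "dn(u := 1)"], rule exI[of _ "t(0 := t 0 + 1)"])
        (use that t dn in \<open>auto simp: take_Suc_conv_app_nth u_def\<close>)
    show ?case
    proof (intro wp_Seq wp_NWrite, goal_cases)
      case 3
      show ?case using new k' t xs(3)[OF t]
        by (simp add: s' u_def fun_upd_twist)
    qed (use k' t in simp_all)
  next
    case (4 k' s')
    then obtain dn t where s': "s' = s0\<lparr>nmem := (nmem s0)(''done'' := dn, ''t'' := t)\<rparr>"
      and t: "t 0 \<le> length xs"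
      and dn: "\<forall>v. dn v \<noteq> 0 \<longleftrightarrow> v \<in> set (take (t 0) xs)" and k': "30 * (length xs - t 0) + x + 10 \<le> k'"
      unfolding J_def by blast
    have "t 0 = length xs" using 4(2) xs t by (simp add: s')
    thus ?case using dn k' unfolding s' by (intro post) auto
  qed
qed

lemma list_cells:
  assumes "same_input s" "u \<in> nodes X"
  shows "nmem s ''Lsize'' u = length (L u)"
    and "t < length (L u) \<Longrightarrow> rmem s ''Lx'' (nmem s ''Lpos'' u + t) = fst (L u ! t) \<and>
      rmem s ''Ly'' (nmem s ''Lpos'' u + t) = snd (L u ! t)"
  using assms input unfolding input_memory_def same_input_def by auto

lemma valid_assign_t [simp]: "valid P Do R (s\<lparr>nmem := (nmem s)(''t'' := f)\<rparr>) \<longleftrightarrow> valid P Do R s"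
  by (simp add: valid_def same_input_def)

lemma credit_assign_t [simp]: "credit R (s\<lparr>nmem := (nmem s)(''t'' := f)\<rparr>) = credit R s"
  by (simp add: credit_def)

text \<open>\<open>Do\<close> is \<open>S\<close> throughout and only \<open>P\<close> grows. A seed
  costs at most 100 units besides the credit of its incoming arcs.\<close>

lemma wp_seeds:
  assumes xs: "distinct xs" "set xs = S" "nmem s0 ''nseeds'' 0 = length xs"
      "\<And>t. t < length xs \<Longrightarrow> nmem s0 ''seed'' t = xs ! t"
    and I: "valid {} S {} s" and t0: "nmem s ''t'' 0 = 0"
    and k: "credit {} s + 100 * length xs + x + 10 \<le> k"
    and post: "\<And>k' s'. valid S S (in_arcs_of S) s' \<Longrightarrow> credit (in_arcs_of S) s' + x \<le> k' \<Longrightarrow> Q k' s'"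
  shows "wp (While (NLess (V ''t'') (V ''nseeds''))
      (Seq (assign ''u'' (NRead ''seed'' (V ''t'')))
      (Seq (RWrite ''pi'' (V ''u'') (RRead ''Ly'' (NRead ''Lpos'' (V ''u''))))
      (Seq (expand tst) (assign ''t'' (NAdd (V ''t'') (NConst 1))))))) Q k s"
proof -
  define J where "J k' s' \<longleftrightarrow> (\<exists>j\<le>length xs. nmem s' ''t'' 0 = j \<and>
    valid (set (take j xs)) S (in_arcs_of (set (take j xs))) s' \<and>
    credit (in_arcs_of (set (take j xs))) s' + 100 * (length xs - j) + x + 10 \<le> k')" for k' s'
  show ?thesis
  proof (rule wp_While[where I = J], goal_cases)
    case 1
    show ?case unfolding J_def using I k t0 by (intro exI[of _ 0]) auto
  next
    case (2 k' s')
    thus ?case by (auto simp: J_def)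
  next
    case (3 k' s')
    then obtain j where j: "nmem s' ''t'' 0 = j" and
      inv': "valid (set (take j xs)) S (in_arcs_of (set (take j xs))) s'" and
      k': "credit (in_arcs_of (set (take j xs))) s' + 100 * (length xs - j) + x + 10 \<le> k'"
      unfolding J_def by blast
    let ?P = "set (take j xs)"
    have same: "same_input s'" using inv' by (simp add: valid_def)
    have jl: "j < length xs" using 3(2) j same xs(3) by (simp add: same_input_def)
    define u where "u = xs ! j"
    have uS: "u \<in> S" using jl xs(2) by (auto simp: u_def)
    have un: "u \<in> nodes X" using uS seeds_subset by blast
    have uP: "u \<notin> ?P" using xs(1) jl by (auto simp: u_def in_set_conv_nth nth_eq_iff_index_eq)
    have P': "set (take (Suc j) xs) = insert u ?P" using jl by (simp add: take_Suc_conv_app_nth u_def)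
    have arcs': "in_arcs_of (insert u ?P) = in_arcs_of ?P \<union> {e \<in> near_arcs. snd e = u}" by auto
    have seed: "nmem s' ''seed'' j = u" using same xs(4)[OF jl] by (simp add: same_input_def u_def)
    note list = estimate_list_first[OF lists[OF un]]
    have Ly: "rmem s' ''Ly'' (nmem s' ''Lpos'' u) = nhat X u 0"
      using list_cells(2)[OF same un, of 0] list by simp
    define s1 where "s1 = s'\<lparr>nmem := (nmem s')(''u'' := (nmem s' ''u'')(0 := u)),
      rmem := (rmem s')(''pi'' := (rmem s' ''pi'')(u := nhat X u 0))\<rparr>"
    have inv1: "valid ?P S (in_arcs_of ?P) s1"
      using inv' search_set_rank[OF _ uP] by (simp add: valid_def same_input_def s1_def)
    have cells: "nmem s1 ''u'' 0 = u" "rmem s1 ''pi'' u = nhat X u 0" "nmem s1 ''t'' 0 = j"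
      by (simp_all add: s1_def j)
    have expand: "wp (Seq (expand tst) (assign ''t'' (NAdd (V ''t'') (NConst 1)))) J k'' s1"
      if k'': "credit (in_arcs_of ?P) s1 + (100 * (length xs - Suc j) + x + 20) + 60 \<le> k''" for k''
    proof (intro wp_Seq wp_expand[OF inv1 cells(1) uS uP, where y = 0, OF cells(2) _ _ _ k''], goal_cases)
      case 1
      show ?case using seed_dist_seed[OF uS] by (simp add: zero_ereal_def)
    next
      case 2
      show ?case using seed_dist_seed[OF uS] by (simp add: zero_ereal_def)
    next
      case (3 v)
      show ?case using uP by simp
    next
      case (4 k2 s2)
      show ?case
      proof (rule wp_NWrite, goal_cases)
        case 1
        show ?case using 4 by simp
      next
        case 2
        have "nmem s2 ''t'' 0 = j" using 4(3) cells(3) by simp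
        moreover have "valid (set (take (Suc j) xs)) S (in_arcs_of (set (take (Suc j) xs))) s2"
          using 4(1) by (simp only: P' arcs')
        moreover have "credit (in_arcs_of (set (take (Suc j) xs))) s2 + (100 * (length xs - Suc j) + x + 20) \<le> k2"
          using 4(2) by (simp only: P' arcs')
        ultimately show ?case unfolding J_def using jl by (intro exI[of _ "Suc j"]) simp
      qed
    qed
    show ?case
    proof (rule wp_Seq, rule wp_NWrite, goal_cases)
      case 2
      show ?case
      proof (rule wp_Seq, rule wp_RWrite, goal_cases)
        case 2
        have "credit (in_arcs_of ?P) s1 = credit (in_arcs_of ?P) s'" by (simp add: credit_def s1_def)
        with k' jl have k1: "credit (in_arcs_of ?P) s1 + (100 * (length xs - Suc j) + x + 20) + 80 \<le> k'"
          by simp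
        show ?case
          by (rule subst[of s1 _ "wp _ J _"], simp add: s1_def seed Ly j, rule expand, use k1 in simp)
      qed (use k' jl in simp)
    qed (use k' jl in simp)
  next
    case (4 k' s')
    then obtain j where j: "nmem s' ''t'' 0 = j" "j \<le> length xs" and
      inv': "valid (set (take j xs)) S (in_arcs_of (set (take j xs))) s'" and
      k': "credit (in_arcs_of (set (take j xs))) s' + 100 * (length xs - j) + x + 10 \<le> k'"
      unfolding J_def by blast
    have "same_input s'" using inv' by (simp add: valid_def)
    hence "j = length xs" using 4(2) j xs(3) by (simp add: same_input_def)
    thus ?case using inv' k' xs(2) by (intro post) auto
  qed
qed


text \<open>Between rounds \<open>P\<close> equals \<open>Do\<close> and exactly the near arcs into
  \<open>Do\<close> are relaxed. Within a round \<open>u\<close> enters \<open>Do\<close> when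
  extracted, and \<open>P\<close> once its rank is known.\<close>

lemma wp_queue:
  assumes I: "valid S S (in_arcs_of S) s" and k: "credit (in_arcs_of S) s + 10 \<le> k"
    and post: "\<And>k' s' Do. valid Do Do (in_arcs_of Do) s' \<Longrightarrow> nmem s' ''win'' 1 = 0 \<Longrightarrow> Q k' s'"
  shows "wp (While (NLess (NConst 0) (NRead ''win'' (NConst 1)))
      (Seq (assign ''u'' (NSub (NRead ''win'' (NConst 1)) (NConst 1)))
      (Seq (NWrite ''done'' (V ''u'') (NConst 1))
      (Seq (assign ''p'' (NAdd (V ''n'') (V ''u'')))
      (Seq (NWrite ''win'' (V ''p'') (NConst 0))
      (Seq tree_up (Seq lookup (expand tst)))))))) Q k s"
proof -
  define J where "J k' s' \<longleftrightarrow> (\<exists>Do. valid Do Do (in_arcs_of Do) s' \<and> credit (in_arcs_of Do) s' + 10 \<le> k')"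
    for k' s'
  show ?thesis
  proof (rule wp_While[where I = J], goal_cases)
    case 1
    show ?case unfolding J_def using I k by blast
  next
    case (2 k' s')
    thus ?case by (auto simp: J_def)
  next
    case (3 k' s')
    then obtain Do where inv': "valid Do Do (in_arcs_of Do) s'" and
      k': "credit (in_arcs_of Do) s' + 10 \<le> k'"
      unfolding J_def by blast
    have same: "same_input s'" and search: "search Do Do (in_arcs_of Do) (nmem s' ''win'')
        (rmem s' ''dist'') (nmem s' ''done'') (nmem s' ''found'') (rmem s' ''pi'')"
      using inv' by (simp_all add: valid_def)
    have tour: "tournament N (nmem s' ''win'') (rmem s' ''dist'')"
      and Do: "Do \<subseteq> nodes X" and closed: "\<forall>v\<in>nodes X. nmem s' ''win'' (N + v) \<noteq> 0 \<longrightarrow> v \<notin> Do"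
      using search unfolding search_def by simp_all
    have "nmem s' ''win'' 1 \<noteq> 0" using 3(2) by simp
    then obtain u where u: "u < N" "nmem s' ''win'' 1 = u + 1" "nmem s' ''win'' (N + u) \<noteq> 0"
      and min: "\<And>w. w < N \<Longrightarrow> nmem s' ''win'' (N + w) \<noteq> 0 \<Longrightarrow> rmem s' ''dist'' u \<le> rmem s' ''dist'' w"
      using tournament_root_min[OF tour] by metis
    have un: "u \<in> nodes X" using u(1) by (simp only: node_iff)
    have uDo: "u \<notin> Do" using closed un u(3) by blast
    have n: "nmem s' ''n'' 0 = N" by (rule n_cell[OF same])
    have "u \<in> queued (nmem s' ''win'')" using u(1,3) by (simp add: queued_def)
    hence "qsize s' \<noteq> 0" using finite_queued by auto
    \<comment> \<open>A nonempty queue guarantees the credit for one extraction.\<close>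
    hence rich: "120 * K + 210 \<le> k'" using k' by (cases "qsize s'") (auto simp: credit_def)
    define s1 where "s1 = s'\<lparr>nmem := (nmem s')(''u'' := (nmem s' ''u'')(0 := u),
      ''done'' := (nmem s' ''done'')(u := 1), ''p'' := (nmem s' ''p'')(0 := N + u),
      ''win'' := (nmem s' ''win'')(N + u := 0))\<rparr>"
    have body: "wp (Seq tree_up (Seq lookup (expand tst))) J k1 s1" if k1: "k' \<le> k1 + 40" for k1
    proof (rule wp_Seq, rule wp_tree_up[where n = N and K = K], goal_cases)
      case 1
      \<comment> \<open>Deletion keeps the key; the idle update of \<open>dist\<close> only matches
        the shape of \<open>repaired_below_leaf\<close>.\<close>
      have "repaired_below N ((nmem s' ''win'')(N + u := 0))
          ((rmem s' ''dist'')(u := rmem s' ''dist'' u)) (N + u)"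
        by (rule repaired_below_leaf[OF tour u(1)]) simp
      thus ?case by (simp add: s1_def)
    next
      case (6 k2 win p)
      define s2 where "s2 = s1\<lparr>nmem := (nmem s1)(''win'' := win, ''p'' := p)\<rparr>"
      have win: "win j = ((nmem s' ''win'')(N + u := 0)) j" if "N \<le> j" for j
        using 6(3) that by (simp add: s1_def)
      have tour2: "tournament N win (rmem s' ''dist'')" using 6(2) by (simp add: s1_def)
      have search2: "search Do (insert u Do) (in_arcs_of Do) win (rmem s' ''dist'')
          ((nmem s' ''done'')(u := 1)) (nmem s' ''found'') (rmem s' ''pi'')"
        by (rule search_pop[OF search u(1) u(3) min tour2 win])
      have dist: "D u \<le> ereal (rmem s' ''dist'' u)" "u \<in> near \<Longrightarrow> D u = ereal (rmem s' ''dist'' u)"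
        using search2 un unfolding search_def by simp_all
      have same2: "same_input s2" using same by (simp add: s2_def s1_def same_input_def)
      have u2: "nmem s2 ''u'' 0 = u" "rmem s2 = rmem s'" by (simp_all add: s2_def s1_def)
      have "qsize s2 + 1 = qsize s'"
        using card_queued_remove[of win "nmem s' ''win''", OF win] u(1,3)
        by (simp add: s2_def queued_def)
      hence credit2: "credit R s2 + (120 * K + 200) = credit R s'" for R by (rule credit_pop)
      note list = lists[OF un] and first = estimate_list_first[OF lists[OF un]]
      have "length (L u) \<le> N" using list by (simp add: estimate_list_def)
      hence len: "length (L u) \<le> 2 ^ K" using nodes_le by simp
      have sorted: "sorted_wrt (<) (map fst (L u))" using list by (simp add: estimate_list_def)
      \<comment> \<open>The first key of the list is 0, so this makes 0 a legal lower end for the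
        binary search.\<close>
      have nonneg: "0 \<le> rmem s' ''dist'' u"
        using order_trans[OF seed_dist_nonneg dist(1)] by simp
      show ?case unfolding s2_def[symmetric]
      proof (rule wp_Seq, rule wp_lookup[where xs = "L u" and K = K], goal_cases)
        case 1
        show ?case using list_cells(1)[OF same2 un] u2 by simp
      next
        case (4 t)
        thus ?case using list_cells(2)[OF same2 un, of t] u2 by simp
      next
        case (8 k3 lo hi mid l)
        define s3 where "s3 = s2\<lparr>nmem := (nmem s2)(''lo'' := lo, ''hi'' := hi, ''mid'' := mid),
          rmem := (rmem s2)(''pi'' := (rmem s2 ''pi'')(u := snd (L u ! l)))\<rparr>"
        have val: "snd (L u ! l) = nhat X u (rmem s' ''dist'' u)"
          using estimate_list_lookup[OF list 8(2)] 8(3,4) u2 by simp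
        have inv3: "valid Do (insert u Do) (in_arcs_of Do) s3"
          using search_set_rank[OF search2 uDo] same
          by (simp add: valid_def same_input_def s3_def s2_def s1_def)
        have u3: "nmem s3 ''u'' 0 = u" "u \<in> insert u Do" "rmem s3 ''pi'' u = nhat X u (rmem s' ''dist'' u)"
          by (simp_all add: s3_def u2 val)
        have credit3: "credit (in_arcs_of Do) s3 = credit (in_arcs_of Do) s2"
          by (simp add: credit_def s3_def)
        have arcs': "in_arcs_of (insert u Do) = in_arcs_of Do \<union> {e \<in> near_arcs. snd e = u}" by auto
        have "wp (expand tst) J k3 s3"
        proof (rule wp_expand[OF inv3 u3(1,2) uDo u3(3) dist, where x = 10], goal_cases)
          case 2
          show ?case using uDo by simp
        next
          case 3
          show ?case using 8(1) 6(1) k1 k' credit3 credit2[of "in_arcs_of Do"] by linarith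
        next
          case (4 k4 s4)
          have "valid (insert u Do) (insert u Do) (in_arcs_of (insert u Do)) s4"
            using 4(1) by (simp only: arcs')
          moreover have "credit (in_arcs_of (insert u Do)) s4 + 10 \<le> k4"
            using 4(2) by (simp only: arcs')
          ultimately show ?case unfolding J_def by blast
        qed
        thus ?case by (simp add: s3_def u2)
      qed (use first len sorted nonneg u2 6(1) k1 rich in simp_all)
    qed (use u nodes_le k1 rich in \<open>auto simp: s1_def\<close>)
    show ?case
    proof (intro wp_Seq[of "assign _ _"] wp_Seq[of "NWrite _ _ _"] wp_NWrite, goal_cases)
      case 5
      show ?case
        by (rule subst[of s1 _ "wp _ J _"], use u n in \<open>simp add: s1_def fun_upd_twist\<close>,
          rule body, use rich in simp)
    qed (use rich in simp_all)
  next
    case (4 k' s')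
    thus ?case unfolding J_def using post by auto
  qed
qed

text \<open>The two seed loops account for 30 and 100 units per seed. The queue starts empty, so the
  initial credit consists of the arcs alone.\<close>

lemma main_correct:
  obtains t s' where "exec (main tst) s0 t s'"
    "t \<le> 130 * card S + (200 * K + 400) * card near_arcs + 60"
    "\<And>v. v \<in> nodes X \<Longrightarrow> out_rank s' v = (if v \<in> near then est_rank_set X S v else \<infinity>)"
proof -
  obtain xs where xs: "distinct xs" "set xs = S" "nmem s0 ''nseeds'' 0 = length xs"
      "\<And>t. t < length xs \<Longrightarrow> nmem s0 ''seed'' t = xs ! t"
    using input unfolding input_memory_def by metis
  have len: "length xs = card S" using xs(1,2) distinct_card by metis
  have zero: "nmem s0 ''win'' = (\<lambda>_. 0)" "rmem s0 ''dist'' = (\<lambda>_. 0)" "nmem s0 ''found'' = (\<lambda>_. 0)"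
    using input unfolding input_memory_def by auto
  define Q where "Q k s \<longleftrightarrow>
    (\<forall>v\<in>nodes X. out_rank s v = (if v \<in> near then est_rank_set X S v else \<infinity>))" for k :: nat and s
  define x where "x = (200 * K + 400) * card near_arcs"
  have init: "valid {} S {} (s0\<lparr>nmem := (nmem s0)(''done'' := dn, ''t'' := f)\<rparr>)"
    if "\<forall>v. dn v \<noteq> 0 \<longleftrightarrow> v \<in> S" for dn f
    using search_init[of dn] that by (simp add: valid_def same_input_def zero)
  have "wp (main tst) Q (130 * card S + x + 60) s0"
    unfolding main_def
  proof (rule wp_Seq, rule wp_seed_flags[OF xs(1,3,4), where x = "100 * card S + x + 40"], goal_cases)
    case 2
    show ?case using len by simp
  next
    case (3 k dn t)
    show ?case
    proof (rule wp_Seq, rule wp_NWrite, goal_cases)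
      case 2
      show ?case
      proof (rule wp_Seq, rule wp_seeds[OF xs, where x = 10], goal_cases)
        case 2
        show ?case using init[of dn] 3(1) xs(2) by simp
      next
        case 4
        show ?case using 3(2) len by (simp add: credit_def zero x_def queued_def)
      next
        case (5 k' s')
        show ?case
        proof (rule wp_queue[OF 5], goal_cases)
          case (1 k2 s2 Do)
          hence search: "search Do Do (in_arcs_of Do) (nmem s2 ''win'') (rmem s2 ''dist'')
            (nmem s2 ''done'') (nmem s2 ''found'') (rmem s2 ''pi'')" by (simp add: valid_def)
          show ?case unfolding Q_def out_rank_def
          proof
            fix v assume v: "v \<in> nodes X"
            show "(if nmem s2 ''found'' v = 0 then \<infinity> else ereal (rmem s2 ''pi'' v)) =
              (if v \<in> near then est_rank_set X S v else \<infinity>)"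
              using search_final[OF search 1(2) v] by auto
          qed
        qed
      qed simp_all
    qed (use 3(2) in simp)
  qed simp_all
  then obtain t s' where "exec (main tst) s0 t s'" "t \<le> 130 * card S + x + 60" "Q 0 s'"
    unfolding wp_def Q_def by blast
  thus ?thesis using that unfolding Q_def x_def by blast
qed

end

section \<open>Operation count\<close>

text \<open>An unordered pair comes from at most two arcs: on the arcs with
  \<open>u \<le> v\<close>, and on the others, forgetting the direction is injective.\<close>

lemma card_arcs_le_edge_count:
  assumes "finite A"
  shows "card A \<le> 2 * edge_count X A"
proof -
  let ?f = "\<lambda>(u::nat, v). {u, v}"
  let ?B = "{e \<in> A. fst e \<le> snd e}" and ?C = "{e \<in> A. \<not> fst e \<le> snd e}"
  have "inj_on ?f ?B" "inj_on ?f ?C" by (auto simp: inj_on_def doubleton_eq_iff)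
  hence "card ?B = card (?f ` ?B)" "card ?C = card (?f ` ?C)" by (simp_all add: card_image)
  moreover have "card (?f ` ?B) \<le> card (?f ` A)" "card (?f ` ?C) \<le> card (?f ` A)"
    using assms by (auto intro!: card_mono)
  moreover have "card A = card ?B + card ?C"
  proof -
    have "A = ?B \<union> ?C" by blast
    thus ?thesis using assms card_Un_disjoint[of ?B ?C] by force
  qed
  ultimately show ?thesis by (auto simp: edge_count_def)
qed

context thresholded_search
begin

lemma est_rank_set_nonneg: "0 \<le> est_rank_set X S v"
  by (simp add: est_rank_set_eq nhat_nonneg)

text \<open>For at least two nodes, \<open>K \<le> log 2 N + 1\<close> and
  \<open>1 \<le> log 2 N\<close> give \<open>200 * K + 400 \<le> 800 * log 2 N\<close>; counting
  edges instead of arcs doubles this to 1600.\<close>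

lemma cost_bound_main:
  fixes t :: nat
  defines "K \<equiv> nat \<lceil>log 2 (real N)\<rceil>"
  assumes t: "t \<le> 130 * card S + (200 * K + 400) * card near_arcs + 60"
  shows "cost_bound X S (edge_count X {e \<in> E. est_rank_set X S (snd e) \<le> \<theta>}) 1600 t"
proof -
  let ?A = "{e \<in> E. est_rank_set X S (snd e) \<le> \<theta>}"
  define m where "m = edge_count X ?A"
  have "card near_arcs \<le> card ?A"
    using finite_arcs by (intro card_mono) (auto simp: near_arcs_def near_def)
  also have "card ?A \<le> 2 * m" unfolding m_def using finite_arcs by (intro card_arcs_le_edge_count) auto
  finally have arcs: "real (card near_arcs) \<le> 2 * real m" by linarith
  have S: "real (card S) \<le> real (max 1 (card S))" "1 \<le> real (max 1 (card S))" by auto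
  have tt: "real t \<le> 130 * card S + (200 * real K + 400) * card near_arcs + 60"
    using of_nat_mono[OF t, where 'a = real] by simp
  have "(200 * real K + 400) * card near_arcs \<le> 1600 * (m * log 2 N) + 400"
  proof (cases "N \<le> 1")
    \<comment> \<open>A single node may carry a loop although the logarithm is 0; the constant cost
      of this one arc is charged to the seed term. For no nodes, \<open>log 2 0 = 0\<close> in
      HOL.\<close>
    case True
    have "near_arcs \<subseteq> {(0, 0)}"
      using arc_nodes True node_iff unfolding near_arcs_def by (fastforce simp: less_Suc_eq)
    hence "card near_arcs \<le> 1" using card_mono[of "{(0, 0)}" near_arcs] by simp
    moreover have "N = 0 \<or> N = 1" using True by linarith
    hence "log 2 N = 0" "K = 0" by (auto simp: K_def log_def)
    ultimately show ?thesis by simp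
  next
    case False
    hence lg: "1 \<le> log 2 N" using le_log_iff[of 2 N 1] by simp
    have "real K \<le> log 2 N + 1" unfolding K_def using lg by linarith
    hence "200 * real K + 400 \<le> 800 * log 2 N" using lg by simp
    hence "(200 * real K + 400) * card near_arcs \<le> (800 * log 2 N) * (2 * real m)"
      using arcs lg by (intro mult_mono) auto
    thus ?thesis by (simp add: mult_ac)
  qed
  hence "real t \<le> 130 * card S + 1600 * (m * log 2 N) + 460" using tt by linarith
  also have "\<dots> \<le> 1600 * (real (max 1 (card S)) + m * log 2 N)" using S by (simp add: distrib_left)
  finally show ?thesis unfolding cost_bound_def m_def .
qed

lemma nodes_le_power: "N \<le> 2 ^ nat \<lceil>log 2 (real N)\<rceil>"
proof (cases "N = 0")
  case False
  hence "real N = 2 powr log 2 N" by simp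
  also have "\<dots> \<le> 2 powr (real (nat \<lceil>log 2 (real N)\<rceil>))" by (intro powr_mono) linarith+
  also have "\<dots> = real (2 ^ nat \<lceil>log 2 (real N)\<rceil>)" by (simp add: powr_realpow)
  finally show ?thesis by (simp only: of_nat_le_iff)
qed simp

end

lemma main_computes_ranks:
  assumes net: "is_network X" "S \<subseteq> rankees X" "\<forall>j\<in>nodes X. estimate_list X j (L j)" "input_memory X S L s"
    and tst: "\<And>s'. rmem s' ''T'' 0 = rmem s ''T'' 0 \<Longrightarrow>
      bval tst s' \<longleftrightarrow> ereal (rmem s' ''pi'' (nmem s' ''u'' 0)) \<le> \<theta>" "bcost tst \<le> 10"
  obtains t s' where "exec (main tst) s t s'"
    "cost_bound X S (edge_count X {e \<in> parcs (graph X). est_rank_set X S (snd e) \<le> \<theta>}) 1600 t"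
    "\<And>j. j \<in> nodes X \<Longrightarrow> out_rank s' j = (if est_rank_set X S j \<le> \<theta> then est_rank_set X S j else \<infinity>)"
proof -
  interpret thresholded_search X S \<theta> by unfold_locales (use net in auto)
  interpret search_run X S \<theta> L s tst "nat \<lceil>log 2 (real (card (nodes X)))\<rceil>"
    by unfold_locales (use net tst nodes_le_power in auto)
  obtain t s' where run: "exec (main tst) s t s'"
      "t \<le> 130 * card S + (200 * nat \<lceil>log 2 (real N)\<rceil> + 400) * card near_arcs + 60"
      "\<And>v. v \<in> nodes X \<Longrightarrow> out_rank s' v = (if v \<in> near then est_rank_set X S v else \<infinity>)"
    using main_correct by blast
  \<comment> \<open>The two conditions differ only at unreachable nodes, where either branch yields
    \<open>\<infinity>\<close>.\<close>
  have "(if v \<in> near then est_rank_set X S v else \<infinity>) =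
      (if est_rank_set X S v \<le> \<theta> then est_rank_set X S v else \<infinity>)" if "v \<in> nodes X" for v
    using that by (cases "D v = \<infinity>") (auto simp: near_def est_rank_set_eq)
  thus ?thesis using that[OF run(1) cost_bound_main[OF run(2)]] run(3) by simp
qed

text \<open>The nodes dropped on the right are those output as \<open>\<infinity>\<close>; their
  true rank exceeds \<open>T\<close>, where \<open>\<alpha>\<close> vanishes.\<close>

lemma approx_influence_eq_found:
  assumes net: "is_network X" "S \<subseteq> rankees X"
    and \<alpha>: "\<forall>x\<ge>0. ereal T \<le> x \<longrightarrow> \<alpha> x = 0"
    and out: "\<And>j. j \<in> nodes X \<Longrightarrow>
      out_rank s j = (if est_rank_set X S j \<le> ereal T then est_rank_set X S j else \<infinity>)"
  shows "approx_influence X \<beta> \<alpha> S =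
    (\<Sum>j \<in> {j \<in> nodes X. 0 < \<beta> j \<and> out_rank s j \<le> ereal T}. \<beta> j * \<alpha> (out_rank s j))"
proof -
  interpret thresholded_search X S "ereal T" by unfold_locales (use net in auto)
  have fin: "finite (nodes X)" using pair_fin_digraph.pair_finite_verts[OF pair_fin_graph] .
  show ?thesis unfolding approx_influence_def
  proof (rule sum.mono_neutral_cong_right)
    show "\<forall>j\<in>{j \<in> nodes X. 0 < \<beta> j} - {j \<in> nodes X. 0 < \<beta> j \<and> out_rank s j \<le> ereal T}.
        \<beta> j * \<alpha> (est_rank_set X S j) = 0"
    proof
      fix j assume "j \<in> {j \<in> nodes X. 0 < \<beta> j} - {j \<in> nodes X. 0 < \<beta> j \<and> out_rank s j \<le> ereal T}"
      hence "\<not> est_rank_set X S j \<le> ereal T" using out[of j] by auto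
      hence "\<alpha> (est_rank_set X S j) = 0" using \<alpha> est_rank_set_nonneg[of j] by auto
      thus "\<beta> j * \<alpha> (est_rank_set X S j) = 0" by simp
    qed
  qed (use fin out in \<open>auto split: if_splits\<close>)
qed

theorem theorem5p1:
  shows "(\<exists>P C. \<forall>X S L s.
            is_network X \<longrightarrow> S \<subseteq> rankees X \<longrightarrow> (\<forall>j \<in> nodes X. estimate_list X j (L j)) \<longrightarrow>
            input_memory X S L s \<longrightarrow>
            (\<exists>t s'. exec P s t s' \<and>
               cost_bound X S (edge_count X (parcs (graph X))) C t \<and>
               (\<forall>j \<in> nodes X. out_rank s' j = est_rank_set X S j)))
       \<and> (\<exists>P C. \<forall>X S L s T \<alpha> \<beta>.
            is_network X \<longrightarrow> S \<subseteq> rankees X \<longrightarrow> (\<forall>j \<in> nodes X. estimate_list X j (L j)) \<longrightarrow>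
            input_memory X S L s \<longrightarrow> rmem s ''T'' 0 = T \<longrightarrow>
            decay_function \<alpha> \<longrightarrow> (\<forall>x \<ge> 0. ereal T \<le> x \<longrightarrow> \<alpha> x = 0) \<longrightarrow>
            (\<forall>j \<in> nodes X. 0 \<le> \<beta> j) \<longrightarrow>
            (\<exists>t s'. exec P s t s' \<and>
               cost_bound X S
                 (edge_count X {e \<in> parcs (graph X). est_rank_set X S (snd e) \<le> ereal T}) C t \<and>
               (\<forall>j \<in> nodes X. out_rank s' j =
                  (if est_rank_set X S j \<le> ereal T then est_rank_set X S j else \<infinity>)) \<and>
               approx_influence X \<beta> \<alpha> S =
                 (\<Sum>j \<in> {j \<in> nodes X. 0 < \<beta> j \<and> out_rank s' j \<le> ereal T}.
                    \<beta> j * \<alpha> (out_rank s' j))))"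
proof
  \<comment> \<open>The language has no Boolean constants, so truth is written as a comparison; the
    threshold is \<open>\<infinity>\<close> here.\<close>
  let ?always = "NLess (NConst 0) (NConst 1)"
  show "\<exists>P C. \<forall>X S L s.
            is_network X \<longrightarrow> S \<subseteq> rankees X \<longrightarrow> (\<forall>j \<in> nodes X. estimate_list X j (L j)) \<longrightarrow>
            input_memory X S L s \<longrightarrow>
            (\<exists>t s'. exec P s t s' \<and>
               cost_bound X S (edge_count X (parcs (graph X))) C t \<and>
               (\<forall>j \<in> nodes X. out_rank s' j = est_rank_set X S j))"
  proof (rule exI[of _ "main ?always"], rule exI[of _ 1600], intro allI impI)
    fix X S L s
    assume net: "is_network X" "S \<subseteq> rankees X" "\<forall>j \<in> nodes X. estimate_list X j (L j)"
      "input_memory X S L s"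
    obtain t s' where "exec (main ?always) s t s'"
      "cost_bound X S (edge_count X {e \<in> parcs (graph X). est_rank_set X S (snd e) \<le> \<infinity>}) 1600 t"
      "\<And>j. j \<in> nodes X \<Longrightarrow> out_rank s' j = (if est_rank_set X S j \<le> \<infinity> then est_rank_set X S j else \<infinity>)"
      by (rule main_computes_ranks[OF net, of ?always \<infinity>]) simp_all
    thus "\<exists>t s'. exec (main ?always) s t s' \<and>
        cost_bound X S (edge_count X (parcs (graph X))) 1600 t \<and>
        (\<forall>j \<in> nodes X. out_rank s' j = est_rank_set X S j)" by auto
  qed
next
  \<comment> \<open>The weak comparison of the rank with \<open>T\<close> is a negated strict one,
    and ranks equal to \<open>T\<close> pass.\<close>
  let ?below = "BNot (RLess (RRead ''T'' (NConst 0)) (RRead ''pi'' (V ''u'')))"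
  show "\<exists>P C. \<forall>X S L s T \<alpha> \<beta>.
            is_network X \<longrightarrow> S \<subseteq> rankees X \<longrightarrow> (\<forall>j \<in> nodes X. estimate_list X j (L j)) \<longrightarrow>
            input_memory X S L s \<longrightarrow> rmem s ''T'' 0 = T \<longrightarrow>
            decay_function \<alpha> \<longrightarrow> (\<forall>x \<ge> 0. ereal T \<le> x \<longrightarrow> \<alpha> x = 0) \<longrightarrow>
            (\<forall>j \<in> nodes X. 0 \<le> \<beta> j) \<longrightarrow>
            (\<exists>t s'. exec P s t s' \<and>
               cost_bound X S
                 (edge_count X {e \<in> parcs (graph X). est_rank_set X S (snd e) \<le> ereal T}) C t \<and>
               (\<forall>j \<in> nodes X. out_rank s' j =
                  (if est_rank_set X S j \<le> ereal T then est_rank_set X S j else \<infinity>)) \<and>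
               approx_influence X \<beta> \<alpha> S =
                 (\<Sum>j \<in> {j \<in> nodes X. 0 < \<beta> j \<and> out_rank s' j \<le> ereal T}.
                    \<beta> j * \<alpha> (out_rank s' j)))"
  proof (rule exI[of _ "main ?below"], rule exI[of _ 1600], intro allI impI)
    fix X S L s T and \<alpha> :: "ereal \<Rightarrow> real" and \<beta> :: "nat \<Rightarrow> real"
    assume net: "is_network X" "S \<subseteq> rankees X" "\<forall>j \<in> nodes X. estimate_list X j (L j)"
      "input_memory X S L s" and T: "rmem s ''T'' 0 = T"
      and \<alpha>: "\<forall>x \<ge> 0. ereal T \<le> x \<longrightarrow> \<alpha> x = 0"
    obtain t s' where run: "exec (main ?below) s t s'"
      "cost_bound X S (edge_count X {e \<in> parcs (graph X). est_rank_set X S (snd e) \<le> ereal T}) 1600 t"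
      and out: "\<And>j. j \<in> nodes X \<Longrightarrow>
        out_rank s' j = (if est_rank_set X S j \<le> ereal T then est_rank_set X S j else \<infinity>)"
      by (rule main_computes_ranks[OF net, of ?below "ereal T"]) (simp_all add: T not_less)
    show "\<exists>t s'. exec (main ?below) s t s' \<and>
        cost_bound X S
          (edge_count X {e \<in> parcs (graph X). est_rank_set X S (snd e) \<le> ereal T}) 1600 t \<and>
        (\<forall>j \<in> nodes X. out_rank s' j =
          (if est_rank_set X S j \<le> ereal T then est_rank_set X S j else \<infinity>)) \<and>
        approx_influence X \<beta> \<alpha> S =
          (\<Sum>j \<in> {j \<in> nodes X. 0 < \<beta> j \<and> out_rank s' j \<le> ereal T}. \<beta> j * \<alpha> (out_rank s' j))"
      using run out approx_influence_eq_found[OF net(1,2) \<alpha> out] by blast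
  qed
qed

end
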